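(* Let $\mathfrak g$ be a $2k$-dimensional ($2k\ge4$) symplectic filiform Lie algebra over $\mathbb R$. Then $\mathfrak g$ is a filtered deformation of some $\mathbb N$-graded symplectic filiform Lie algebra $\mathfrak g_0$ (so $\mathfrak g_0$ is isomorphic to one of $\mathfrak m_0(2k)$; $\mathcal V_6$; $\mathcal V_{2k}$ with $k\ge6$; $\mathfrak g_{8,\alpha}$; $\mathfrak g_{10,\alpha}$, for parameters $\alpha$ for which the algebra is symplectic). That is, $\mathfrak g$ has an adapted basis $e_1,\dots,e_{2k}$ with $[e_i,e_j]\in{\rm Span}(e_{i+j},\dots,e_{2k})$ for all $i,j$, such that ${\rm gr}_L\mathfrak g=\mathfrak g_0$ is symplectic for the associated filtration $L$. For the corresponding symplectic form $\omega(\mathfrak g)$ we have the decomposition $$\omega(\mathfrak g)=\omega_{2k+1,0}+\sum_{i+j<2k+1}\gamma_{ij}\,e^i\wedge e^j,\qquad \gamma_{ij}\in\mathbb R,$$ where $e^1,\dots,e^{2k}$ is the dual basis and $\omega_{2k+1,0}$ is a homogeneous symplectic form of weight $2k+1$ of $\mathfrak g_0$ (a combination of the $e^i\wedge e^j$ with $i+j=2k+1$, which is closed and non-degenerate as a $2$-form on $\mathfrak g_0={\rm gr}_L\mathfrak g$).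
   Context: A filiform Lie algebra is an $n$-dimensional nilpotent Lie algebra whose nil-index is $n-1$ (the descending central sequence $C^1\mathfrak g=\mathfrak g$, $C^{i}\mathfrak g=[\mathfrak g,C^{i-1}\mathfrak g]$ satisfies $C^{n-1}\mathfrak g\ne0$, $C^n\mathfrak g=0$). A Lie algebra is symplectic if it has a non-degenerate closed $2$-form $\omega\in\Lambda^2(\mathfrak g^* )$ (closed for the Chevalley–Eilenberg differential). Adapted basis (here): a basis $e_1,\dots,e_n$ of $\mathfrak g$ with $[e_1,e_i]=e_{i+1}$ for $2\le i\le n-1$ and $[e_i,e_j]=\sum_{l=0}^{n-i-j}c_{ij}^l e_{i+j+l}$ for $i+j\le n$, $[e_i,e_j]=0$ for $i+j>n$. It defines the filtration $L^p\mathfrak g={\rm Span}(e_p,\dots,e_n)$, $p=1,\dots,n$, $L^{n+1}\mathfrak g=0$, with $[L^p\mathfrak g,L^q\mathfrak g]\subset L^{p+q}\mathfrak g$. The associated graded algebra ${\rm gr}_L\mathfrak g=\bigoplus_p L^p\mathfrak g/L^{p+1}\mathfrak g$ is identified with the Lie algebra on the same basis with $[e_i,e_j]=c_{ij}^0e_{i+j}$ for $i+j\le n$ and $0$ otherwise. $\mathfrak g$ is then called a filtered deformation of ${\rm gr}_L\mathfrak g$. An $\mathbb N$-graded filiform Lie algebra is $\mathfrak g=\bigoplus_{i=1}^n\mathfrak g_i$ with $[\mathfrak g_i,\mathfrak g_j]\subset\mathfrak g_{i+j}$, $\dim\mathfrak g_i=1$ for $1\le i\le n$, $[\mathfrak g_1,\mathfrak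 g_i]=\mathfrak g_{i+1}$ for $i\ge2$ (with $\mathfrak g_i=0$ for $i>n$). Algebras (unlisted brackets $[e_i,e_j]$, $i<j$, zero): $\mathfrak m_0(n)$: $[e_1,e_i]=e_{i+1}$, $2\le i\le n-1$. $\mathcal V_n$: $[e_i,e_j]=(j-i)e_{i+j}$ for $i+j\le n$. $\mathfrak g_{8,\alpha}$ (dimension 8): relations (1), (2); $\mathfrak g_{10,\alpha}$ (dimension 10, $\alpha\neq-\frac52$): relations (1)–(4), where (1) $[e_1,e_i]=e_{i+1}$ ($i=2,\dots,6$), $[e_2,e_3]=(2+\alpha)e_5$, $[e_2,e_4]=(2+\alpha)e_6$, $[e_2,e_5]=(1+\alpha)e_7$, $[e_3,e_4]=e_7$; (2) $[e_1,e_7]=e_8$, $[e_2,e_6]=\alpha e_8$, $[e_3,e_5]=e_8$; (3) $[e_1,e_8]=e_9$, $[e_2,e_7]=\frac{2\alpha^2+3\alpha-2}{2\alpha+5}e_9$, $[e_3,e_6]=\frac{2\alpha+2}{2\alpha+5}e_9$, $[e_4,e_5]=\frac3{2\alpha+5}e_9$; (4) $[e_1,e_9]=e_{10}$, $[e_2,e_8]=\frac{2\alpha^2+\alpha-1}{2\alpha+5}e_{10}$, $[e_3,e_7]=\frac{2\alpha-1}{2\alpha+5}e_{10}$, $[e_4,e_6]=\frac3{2\alpha+5}e_{10}$. *)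

theory Defs
  imports "HOL-Analysis.Analysis"
begin

text \<open>A real Lie algebra is a type of class \<^class>\<open>real_vector\<close> together with a bracket
  on it; the carrier is the whole type, so subspaces of the algebra are sets and its dimension is
  that of \<^term>\<open>UNIV\<close>.\<close>

definition lie_algebra :: "('a::real_vector \<Rightarrow> 'a \<Rightarrow> 'a) \<Rightarrow> bool" where
  "lie_algebra br \<longleftrightarrow> bilinear br \<and> (\<forall>x. br x x = 0) \<and>
     (\<forall>x y z. br x (br y z) + br y (br z x) + br z (br x y) = 0)"

definition lie_isomorphic ::
    "('a::real_vector \<Rightarrow> 'a \<Rightarrow> 'a) \<Rightarrow> ('b::real_vector \<Rightarrow> 'b \<Rightarrow> 'b) \<Rightarrow> bool" where
  "lie_isomorphic br br' \<longleftrightarrow>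
     (\<exists>\<phi>. linear \<phi> \<and> bij \<phi> \<and> (\<forall>x y. \<phi> (br x y) = br' (\<phi> x) (\<phi> y)))"

text \<open>The descending central sequence is numbered from 1; index 0 is junk.\<close>

fun central_seq :: "('a::real_vector \<Rightarrow> 'a \<Rightarrow> 'a) \<Rightarrow> nat \<Rightarrow> 'a set" where
  "central_seq br 0 = UNIV"
| "central_seq br (Suc 0) = UNIV"
| "central_seq br (Suc (Suc i)) = span {br x y | x y. y \<in> central_seq br (Suc i)}"

text \<open>\<^const>\<open>dim\<close> is 0 on infinite-dimensional spaces, so for \<open>n > 0\<close> the dimension
  condition includes finite-dimensionality.\<close>

definition filiform :: "nat \<Rightarrow> ('a::real_vector \<Rightarrow> 'a \<Rightarrow> 'a) \<Rightarrow> bool" where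
  "filiform n br \<longleftrightarrow> lie_algebra br \<and> dim (UNIV :: 'a set) = n \<and>
     central_seq br (n - 1) \<noteq> {0} \<and> central_seq br n = {0}"

definition two_form :: "('a::real_vector \<Rightarrow> 'a \<Rightarrow> real) \<Rightarrow> bool" where
  "two_form \<omega> \<longleftrightarrow> bilinear \<omega> \<and> (\<forall>x. \<omega> x x = 0)"

definition ce_differential ::
    "('a::real_vector \<Rightarrow> 'a \<Rightarrow> 'a) \<Rightarrow> ('a \<Rightarrow> 'a \<Rightarrow> real) \<Rightarrow> 'a \<Rightarrow> 'a \<Rightarrow> 'a \<Rightarrow> real" where
  "ce_differential br \<omega> x y z = - \<omega> (br x y) z + \<omega> (br x z) y - \<omega> (br y z) x"

definition symplectic_form ::
    "('a::real_vector \<Rightarrow> 'a \<Rightarrow> 'a) \<Rightarrow> ('a \<Rightarrow> 'a \<Rightarrow> real) \<Rightarrow> bool" where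
  "symplectic_form br \<omega> \<longleftrightarrow> two_form \<omega> \<and> (\<forall>x y z. ce_differential br \<omega> x y z = 0) \<and>
     (\<forall>x. (\<forall>y. \<omega> x y = 0) \<longrightarrow> x = 0)"

definition symplectic :: "('a::real_vector \<Rightarrow> 'a \<Rightarrow> 'a) \<Rightarrow> bool" where
  "symplectic br \<longleftrightarrow> (\<exists>\<omega>. symplectic_form br \<omega>)"

text \<open>\<open>G i\<close> is the component of degree \<open>i\<close>; it vanishes outside \<open>1, \<dots>, n\<close>.\<close>

definition nat_graded_filiform :: "nat \<Rightarrow> ('a::real_vector \<Rightarrow> 'a \<Rightarrow> 'a) \<Rightarrow> bool" where
  "nat_graded_filiform n br \<longleftrightarrow> filiform n br \<and>
     (\<exists>G :: nat \<Rightarrow> 'a set.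
        (\<forall>i. subspace (G i)) \<and>
        (\<forall>i\<in>{1..n}. dim (G i) = 1) \<and> (\<forall>i. i \<notin> {1..n} \<longrightarrow> G i = {0}) \<and>
        (\<forall>x. \<exists>!f. (\<forall>i. f i \<in> G i) \<and> x = (\<Sum>i=1..n. f i)) \<and>
        (\<forall>i\<ge>1. \<forall>j\<ge>1. \<forall>x\<in>G i. \<forall>y\<in>G j. br x y \<in> G (i + j)) \<and>
        (\<forall>i\<ge>2. span {br x y | x y. x \<in> G 1 \<and> y \<in> G i} = G (i + 1)))"

text \<open>Bases are families \<open>e 1, \<dots>, e n\<close>; values of \<open>e\<close> at other indices are irrelevant.\<close>

definition is_basis :: "nat \<Rightarrow> (nat \<Rightarrow> 'a::real_vector) \<Rightarrow> bool" where
  "is_basis n e \<longleftrightarrow> inj_on e {1..n} \<and> independent (e ` {1..n}) \<and> span (e ` {1..n}) = UNIV"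

definition dual_basis :: "nat \<Rightarrow> (nat \<Rightarrow> 'a::real_vector) \<Rightarrow> nat \<Rightarrow> 'a \<Rightarrow> real" where
  "dual_basis n e i x = representation (e ` {1..n}) x (e i)"

definition filtration :: "nat \<Rightarrow> (nat \<Rightarrow> 'a::real_vector) \<Rightarrow> nat \<Rightarrow> 'a set" where
  "filtration n e p = span (e ` {p..n})"

text \<open>\<open>filtration n e (i + j)\<close> is \<open>{0}\<close> for \<open>i + j > n\<close>, so the last condition covers both
  \<open>[e\<^sub>i, e\<^sub>j] = \<Sum>\<^sub>l c\<^sup>l\<^sub>i\<^sub>j e\<^sub>i\<^sub>+\<^sub>j\<^sub>+\<^sub>l\<close> for \<open>i + j \<le> n\<close> and \<open>[e\<^sub>i, e\<^sub>j] = 0\<close> for \<open>i + j > n\<close>.\<close>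

definition adapted_basis ::
    "nat \<Rightarrow> ('a::real_vector \<Rightarrow> 'a \<Rightarrow> 'a) \<Rightarrow> (nat \<Rightarrow> 'a) \<Rightarrow> bool" where
  "adapted_basis n br e \<longleftrightarrow> is_basis n e \<and>
     (\<forall>i\<in>{2..n-1}. br (e 1) (e i) = e (i + 1)) \<and>
     (\<forall>i\<in>{1..n}. \<forall>j\<in>{1..n}. br (e i) (e j) \<in> filtration n e (i + j))"

text \<open>The bilinear bracket on the span of \<open>e 1, \<dots>, e n\<close> with \<open>[e\<^sub>i, e\<^sub>j] = c i j e\<^sub>i\<^sub>+\<^sub>j\<close> for
  \<open>i + j \<le> n\<close> and \<open>0\<close> otherwise. The associated graded algebra and all model algebras below are
  realised in this way, on the same vector space.\<close>

definition graded_bracket ::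
    "nat \<Rightarrow> (nat \<Rightarrow> 'a::real_vector) \<Rightarrow> (nat \<Rightarrow> nat \<Rightarrow> real) \<Rightarrow> 'a \<Rightarrow> 'a \<Rightarrow> 'a" where
  "graded_bracket n e c x y =
     (\<Sum>i=1..n. \<Sum>j=1..n. if i + j \<le> n
        then (dual_basis n e i x * dual_basis n e j y * c i j) *\<^sub>R e (i + j) else 0)"

text \<open>\<open>gr\<^sub>L\<close> of an algebra with adapted basis \<open>e\<close>: the coefficient of \<open>e\<^sub>i\<^sub>+\<^sub>j\<close> in
  \<open>[e\<^sub>i, e\<^sub>j]\<close> is \<open>c\<^sup>0\<^sub>i\<^sub>j\<close>.\<close>

definition assoc_graded ::
    "nat \<Rightarrow> ('a::real_vector \<Rightarrow> 'a \<Rightarrow> 'a) \<Rightarrow> (nat \<Rightarrow> 'a) \<Rightarrow> 'a \<Rightarrow> 'a \<Rightarrow> 'a" where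
  "assoc_graded n br e =
     graded_bracket n e (\<lambda>i j. dual_basis n e (i + j) (br (e i) (e j)))"

text \<open>Coefficient tables list \<open>[e\<^sub>i, e\<^sub>j]\<close> for \<open>i < j\<close> only.\<close>

definition skew :: "(nat \<Rightarrow> nat \<Rightarrow> real) \<Rightarrow> nat \<Rightarrow> nat \<Rightarrow> real" where
  "skew c i j = (if i < j then c i j else if j < i then - c j i else 0)"

definition m0_bracket :: "nat \<Rightarrow> (nat \<Rightarrow> 'a::real_vector) \<Rightarrow> 'a \<Rightarrow> 'a \<Rightarrow> 'a" where
  "m0_bracket n e = graded_bracket n e (skew (\<lambda>i j. if i = 1 then 1 else 0))"

definition V_bracket :: "nat \<Rightarrow> (nat \<Rightarrow> 'a::real_vector) \<Rightarrow> 'a \<Rightarrow> 'a \<Rightarrow> 'a" where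
  "V_bracket n e = graded_bracket n e (\<lambda>i j. real j - real i)"

definition g8_coeff :: "real \<Rightarrow> nat \<Rightarrow> nat \<Rightarrow> real" where
  "g8_coeff \<alpha> i j =
    (if i = 1 then 1
     else if (i, j) = (2, 3) then 2 + \<alpha>
     else if (i, j) = (2, 4) then 2 + \<alpha>
     else if (i, j) = (2, 5) then 1 + \<alpha>
     else if (i, j) = (3, 4) then 1
     else if (i, j) = (2, 6) then \<alpha>
     else if (i, j) = (3, 5) then 1
     else 0)"

definition g10_coeff :: "real \<Rightarrow> nat \<Rightarrow> nat \<Rightarrow> real" where
  "g10_coeff \<alpha> i j =
    (if (i, j) = (2, 7) then (2 * \<alpha>^2 + 3 * \<alpha> - 2) / (2 * \<alpha> + 5)
     else if (i, j) = (3, 6) then (2 * \<alpha> + 2) / (2 * \<alpha> + 5)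
     else if (i, j) = (4, 5) then 3 / (2 * \<alpha> + 5)
     else if (i, j) = (2, 8) then (2 * \<alpha>^2 + \<alpha> - 1) / (2 * \<alpha> + 5)
     else if (i, j) = (3, 7) then (2 * \<alpha> - 1) / (2 * \<alpha> + 5)
     else if (i, j) = (4, 6) then 3 / (2 * \<alpha> + 5)
     else g8_coeff \<alpha> i j)"

definition g8_bracket :: "(nat \<Rightarrow> 'a::real_vector) \<Rightarrow> real \<Rightarrow> 'a \<Rightarrow> 'a \<Rightarrow> 'a" where
  "g8_bracket e \<alpha> = graded_bracket 8 e (skew (g8_coeff \<alpha>))"

definition g10_bracket :: "(nat \<Rightarrow> 'a::real_vector) \<Rightarrow> real \<Rightarrow> 'a \<Rightarrow> 'a \<Rightarrow> 'a" where
  "g10_bracket e \<alpha> = graded_bracket 10 e (skew (g10_coeff \<alpha>))"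

definition wedge :: "('a \<Rightarrow> real) \<Rightarrow> ('a \<Rightarrow> real) \<Rightarrow> 'a \<Rightarrow> 'a \<Rightarrow> real" where
  "wedge a b x y = a x * b y - a y * b x"

definition homogeneous_two_form ::
    "nat \<Rightarrow> (nat \<Rightarrow> 'a::real_vector) \<Rightarrow> nat \<Rightarrow> ('a \<Rightarrow> 'a \<Rightarrow> real) \<Rightarrow> bool" where
  "homogeneous_two_form n e w \<omega> \<longleftrightarrow>
     (\<exists>\<beta> :: nat \<Rightarrow> nat \<Rightarrow> real. \<forall>x y. \<omega> x y =
        (\<Sum>(i, j) \<in> {(i, j). 1 \<le> i \<and> i < j \<and> j \<le> n \<and> i + j = w}.
           \<beta> i j * wedge (dual_basis n e i) (dual_basis n e j) x y))"

end

theory Submission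
  imports Defs
begin

text \<open>For any adapted basis closedness of a symplectic form \<open>\<omega>\<close> against \<open>e\<^sub>1\<close> forces
  \<open>\<omega>(e\<^sub>i, e\<^sub>j) = 0\<close> for \<open>i + j > 2k + 1\<close>, and then nondegeneracy forces the antidiagonal entries to be
  nonzero, so the part of weight \<open>2k + 1\<close> is symplectic on the associated graded algebra. An adapted
  basis exists because the only obstruction, a bracket \<open>[e\<^sub>i, e\<^sub>2\<^sub>k\<^sub>+\<^sub>1\<^sub>-\<^sub>i] = \<plusminus>\<delta> e\<^sub>2\<^sub>k\<close> as in
  Vergne's second filiform algebra, would put \<open>e\<^sub>2\<^sub>k\<close> into the kernel of \<open>\<omega>\<close>.

  For the classification, \<open>\<omega>\<close> extends the structure constants \<open>c\<^sub>i\<^sub>j\<close> of the graded algebra by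
  one weight, with nonzero entries there. As \<open>c\<^sub>i\<^sub>j = c\<^sub>i\<^sub>+\<^sub>1\<^sub>,\<^sub>j + c\<^sub>i\<^sub>,\<^sub>j\<^sub>+\<^sub>1\<close>, they are determined by
  the \<open>c\<^sub>i\<^sub>,\<^sub>i\<^sub>+\<^sub>1\<close>. If \<open>c\<^sub>3\<^sub>4 = 0\<close> and \<open>2k \<ge> 8\<close>, the nonzero entries of top weight leave only
  \<open>\<mm>\<^sub>0(2k)\<close>. If \<open>c\<^sub>3\<^sub>4 \<noteq> 0\<close> and \<open>2k \<ge> 12\<close>, the Jacobi identities of weights 9, 11 and 12
  force \<open>c\<^sub>2\<^sub>3 = 10 c\<^sub>3\<^sub>4\<close>, the value for \<open>V\<^sub>2\<^sub>k\<close>, and from there on one Jacobi identity per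
  odd weight leaves no freedom.\<close>

section \<open>Structure constants of graded filiform algebras\<close>

text \<open>Up to the sign \<open>(-1)^i\<close>, the recursion for the structure constants is a
  difference equation along each antidiagonal. Above vanishing weights the next ones are constant,
  linear, quadratic, ... in \<open>i\<close>, with one constant of integration per weight; in even
  weights skew symmetry at the middle fixes it. The vanishing arguments play such polynomials
  against a Jacobi identity, a boundary value at index 2 or the middle value.

  The obstacle to an adapted basis is that the descending central sequence gives \<open>e_1\<close>
  and \<open>e_2\<close> the same degree, so brackets fall one degree short. Subtracting a multiple
  of \<open>e_1\<close> from \<open>e_2\<close> removes the first unwanted coefficient, and in each
  later odd weight a Jacobi identity reduces to the square of the free constant. For the last one,
  of weight \<open>2k + 1\<close>, that identity lies beyond the top degree, and the form has to
  take over.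

  The available weights end at \<open>2k + 1\<close>, the weight of the form: 9 and 11 in dimensions
  8 and 10. The identity of weight 12, which closes the system, is first in range for
  \<open>k = 6\<close>; below that the ratio of \<open>c_23\<close> to \<open>c_34\<close> survives
  as the parameter \<alpha>.\<close>

lemma constant_from:
  fixes g :: "nat \<Rightarrow> real"
  assumes "\<And>i. a \<le> i \<Longrightarrow> i < M \<Longrightarrow> g (Suc i) = g i" "a \<le> i" "i \<le> M"
  shows "g i = g a"
  using assms(2,3)
proof (induction i rule: nat_induct_at_least)
  case (Suc i)
  then show ?case using assms(1)[of i] by simp
qed simp

text \<open>With \<open>[e_1, e_i] = e_(i+1)\<close> the Jacobi identity of \<open>e_1\<close>,
  \<open>e_i\<close>, \<open>e_j\<close> is this recursion. It does not see into which degree the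
  brackets fall, so it serves both central series frames and graded algebras; \<open>N\<close> is
  the highest weight \<open>i + j\<close> that it controls.\<close>

locale leibniz_array =
  fixes c :: "nat \<Rightarrow> nat \<Rightarrow> real" and N :: nat
  assumes skew_symmetric: "c j i = - c i j"
    and leibniz: "2 \<le> i \<Longrightarrow> 2 \<le> j \<Longrightarrow> i + j < N \<Longrightarrow> c (Suc i) j + c i (Suc j) = c i j"
begin

definition vanishes_at :: "nat \<Rightarrow> bool" where
  "vanishes_at w \<longleftrightarrow> (\<forall>i\<ge>2. \<forall>j\<ge>2. i + j = w \<longrightarrow> c i j = 0)"

lemma vanishes_atD: "vanishes_at (i + j) \<Longrightarrow> 2 \<le> i \<Longrightarrow> 2 \<le> j \<Longrightarrow> c i j = 0"
  by (auto simp: vanishes_at_def)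

lemma diagonal_zero: "c i i = 0"
  using skew_symmetric[of i i] by simp

lemma vanishes_at_small: "w \<le> 4 \<Longrightarrow> vanishes_at w"
proof -
  have "c i j = 0" if "2 \<le> i" "2 \<le> j" "i + j = w" "w \<le> 4" for i j
  proof -
    from that have "i = 2" "j = 2" by auto
    then show ?thesis by (simp add: diagonal_zero)
  qed
  then show "w \<le> 4 \<Longrightarrow> vanishes_at w" by (auto simp: vanishes_at_def)
qed

lemma alternating:
  assumes "vanishes_at w" "w < N" "2 \<le> i" "2 \<le> j" "i + j = Suc w"
    "2 \<le> i'" "2 \<le> j'" "i' + j' = Suc w"
  shows "c i j = (-1) ^ (i + i') * c i' j'"
proof -
  define g where "g i = (-1) ^ i * c i (Suc w - i)" for i
  have const: "g i = g 2" if "2 \<le> i" "i \<le> w - 1" for i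
  proof (rule constant_from[where g = g, OF _ that])
    fix i assume i: "2 \<le> i" "i < w - 1"
    have "c (Suc i) (w - i) + c i (Suc (w - i)) = c i (w - i)"
      by (rule leibniz) (use i assms in auto)
    also have "\<dots> = 0"
      by (rule vanishes_atD) (use i assms in auto)
    finally have "c (Suc i) (w - i) = - c i (Suc (w - i))" by simp
    then show "g (Suc i) = g i"
      using i by (simp add: g_def Suc_diff_le)
  qed
  have "g i = g i'"
    using const[of i] const[of i'] assms by linarith
  moreover have "g i = (-1) ^ i * c i j" "g i' = (-1) ^ i' * c i' j'"
    using assms by (auto simp: g_def intro!: arg_cong[where f = "c _"])
  ultimately have "(-1) ^ i * ((-1) ^ i * c i j) = (-1) ^ i * ((-1) ^ i' * c i' j')" by simp
  then show ?thesis
    by (simp add: power_add mult.assoc[symmetric] flip: power_mult_distrib)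
qed

lemma vanishes_at_Suc:
  assumes "vanishes_at w" "w < N" "2 \<le> i" "2 \<le> j" "i + j = Suc w" "c i j = 0"
  shows "vanishes_at (Suc w)"
  unfolding vanishes_at_def
proof (intro allI impI)
  fix i' j' :: nat
  assume "2 \<le> i'" "2 \<le> j'" "i' + j' = Suc w"
  then have "c i' j' = (-1) ^ (i' + i) * c i j"
    using alternating[OF assms(1,2), of i' j' i j] assms by simp
  then show "c i' j' = 0" using assms by simp
qed

text \<open>The diagonal entry \<open>c (m + 1) (m + 1)\<close> has this weight, so an even weight
  brings no new freedom.\<close>

lemma vanishes_at_even:
  assumes "vanishes_at (2 * m + 1)" "2 * m + 1 < N" "1 \<le> m"
  shows "vanishes_at (2 * m + 2)"
  using vanishes_at_Suc[OF assms(1,2), of "Suc m" "Suc m"] assms diagonal_zero by simp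

text \<open>Summing the alternating entries of weight \<open>2 * p + 1\<close> gives a sequence that
  is linear in \<open>i\<close> up to sign; the zero on the diagonal at \<open>i = p + 1\<close>
  fixes the constant of integration.\<close>

lemma second_weight:
  assumes "vanishes_at (2 * p)" "2 \<le> p" "2 * p + 2 \<le> N" "2 \<le> i" "2 \<le> j" "i + j = 2 * p + 2"
  shows "c i j = (-1) ^ (i + p) * (real p + 1 - real i) * c p (Suc p)"
proof -
  define g where "g i = (-1) ^ (i + p) * c i (2 * p + 2 - i) + real i * c p (Suc p)" for i
  have const: "g i = g 2" if "2 \<le> i" "i \<le> 2 * p" for i
  proof (rule constant_from[where g = g, OF _ that])
    fix i assume i: "2 \<le> i" "i < 2 * p"
    have "c (Suc i) (2 * p + 1 - i) + c i (Suc (2 * p + 1 - i)) = c i (2 * p + 1 - i)"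
      by (rule leibniz) (use i assms in auto)
    also have "\<dots> = (-1) ^ (i + p) * c p (Suc p)"
      by (rule alternating[OF assms(1)]) (use i assms in auto)
    finally have "(-1) ^ (i + p) * (c (Suc i) (2 * p + 1 - i) + c i (2 * p + 2 - i)) = c p (Suc p)"
      using i by (simp add: Suc_diff_le flip: power_add mult.assoc)
    moreover have "2 * p + 2 - Suc i = 2 * p + 1 - i" using i by simp
    ultimately show "g (Suc i) = g i"
      using i by (simp add: g_def algebra_simps)
  qed
  have "g i = g (p + 1)"
    using const[of i] const[of "p + 1"] assms by linarith
  moreover have "c (p + 1) (2 * p + 2 - (p + 1)) = 0"
    using diagonal_zero[of "p + 1"] by simp
  moreover have "2 * p + 2 - i = j" using assms by simp
  ultimately have "(-1) ^ (i + p) * c i j = (real p + 1 - real i) * c p (Suc p)"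
    by (simp add: g_def algebra_simps)
  then have "(-1) ^ (i + p) * ((-1) ^ (i + p) * c i j) = (-1) ^ (i + p) * ((real p + 1 - real i) * c p (Suc p))"
    by simp
  then show ?thesis by (simp add: mult.assoc[symmetric] flip: power_mult_distrib)
qed

end

section \<open>Jacobi identities of low weight and the ratio of the first two constants\<close>

locale graded_coeffs = leibniz_array +
  assumes jacobi: "2 \<le> i \<Longrightarrow> 2 \<le> j \<Longrightarrow> 2 \<le> l \<Longrightarrow> i + j + l \<le> N \<Longrightarrow>
    c i j * c (i + j) l + c j l * c (j + l) i + c l i * c (l + i) j = 0"
begin

text \<open>Solving the recursion towards smaller \<open>i\<close>, starting next to the diagonal,
  leaves the four constants of odd weight \<open>c 2 3\<close>, \<open>c 3 4\<close>,
  \<open>c 4 5\<close>, \<open>c 5 6\<close>.\<close>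

lemma low_weights:
  shows "6 \<le> N \<Longrightarrow> c 2 4 = c 2 3"
    and "7 \<le> N \<Longrightarrow> c 2 5 = c 2 3 - c 3 4"
    and "8 \<le> N \<Longrightarrow> c 3 5 = c 3 4"
    and "8 \<le> N \<Longrightarrow> c 2 6 = c 2 3 - 2 * c 3 4"
    and "9 \<le> N \<Longrightarrow> c 3 6 = c 3 4 - c 4 5"
    and "9 \<le> N \<Longrightarrow> c 2 7 = c 2 3 - 3 * c 3 4 + c 4 5"
    and "10 \<le> N \<Longrightarrow> c 4 6 = c 4 5"
    and "10 \<le> N \<Longrightarrow> c 3 7 = c 3 4 - 2 * c 4 5"
    and "10 \<le> N \<Longrightarrow> c 2 8 = c 2 3 - 4 * c 3 4 + 3 * c 4 5"
    and "11 \<le> N \<Longrightarrow> c 4 7 = c 4 5 - c 5 6"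
    and "11 \<le> N \<Longrightarrow> c 3 8 = c 3 4 - 3 * c 4 5 + c 5 6"
    and "11 \<le> N \<Longrightarrow> c 2 9 = c 2 3 - 5 * c 3 4 + 6 * c 4 5 - c 5 6"
    and "12 \<le> N \<Longrightarrow> c 5 7 = c 5 6"
    and "12 \<le> N \<Longrightarrow> c 4 8 = c 4 5 - 2 * c 5 6"
    and "12 \<le> N \<Longrightarrow> c 3 9 = c 3 4 - 4 * c 4 5 + 3 * c 5 6"
proof -
  note L = leibniz[of 2 3] leibniz[of 2 4] leibniz[of 2 5] leibniz[of 2 6] leibniz[of 2 7] leibniz[of 2 8]
    leibniz[of 3 4] leibniz[of 3 5] leibniz[of 3 6] leibniz[of 3 7] leibniz[of 3 8]
    leibniz[of 4 5] leibniz[of 4 6] leibniz[of 4 7] leibniz[of 5 6]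
    diagonal_zero[of 3] diagonal_zero[of 4] diagonal_zero[of 5] diagonal_zero[of 6]
  note L' = L[simplified]
  show "6 \<le> N \<Longrightarrow> c 2 4 = c 2 3" using L' by simp
  show "7 \<le> N \<Longrightarrow> c 2 5 = c 2 3 - c 3 4" using L' by simp
  show "8 \<le> N \<Longrightarrow> c 3 5 = c 3 4" using L' by simp
  show "8 \<le> N \<Longrightarrow> c 2 6 = c 2 3 - 2 * c 3 4" using L' by simp
  show "9 \<le> N \<Longrightarrow> c 3 6 = c 3 4 - c 4 5" using L' by simp
  show "9 \<le> N \<Longrightarrow> c 2 7 = c 2 3 - 3 * c 3 4 + c 4 5" using L' by simp
  show "10 \<le> N \<Longrightarrow> c 4 6 = c 4 5" using L' by simp
  show "10 \<le> N \<Longrightarrow> c 3 7 = c 3 4 - 2 * c 4 5" using L' by simp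
  show "10 \<le> N \<Longrightarrow> c 2 8 = c 2 3 - 4 * c 3 4 + 3 * c 4 5" using L' by simp
  show "11 \<le> N \<Longrightarrow> c 4 7 = c 4 5 - c 5 6" using L' by simp
  show "11 \<le> N \<Longrightarrow> c 3 8 = c 3 4 - 3 * c 4 5 + c 5 6" using L' by simp
  show "11 \<le> N \<Longrightarrow> c 2 9 = c 2 3 - 5 * c 3 4 + 6 * c 4 5 - c 5 6" using L' by simp
  show "12 \<le> N \<Longrightarrow> c 5 7 = c 5 6" using L' by simp
  show "12 \<le> N \<Longrightarrow> c 4 8 = c 4 5 - 2 * c 5 6" using L' by simp
  show "12 \<le> N \<Longrightarrow> c 3 9 = c 3 4 - 4 * c 4 5 + 3 * c 5 6" using L' by simp
qed

text \<open>The lowest Jacobi identity without \<open>e_1\<close>, that of \<open>e_2\<close>,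
  \<open>e_3\<close>, \<open>e_4\<close>. Weight 10 adds nothing: the Jacobi expression obeys a
  Leibniz rule for \<open>e_1\<close>, so the only triple 2, 3, 5 of that weight follows from this
  one.\<close>

lemma relation9:
  assumes "9 \<le> N"
  shows "c 4 5 * (2 * c 2 3 + c 3 4) = 3 * (c 3 4)^2"
  using jacobi[of 2 3 4] skew_symmetric[of 4 5] skew_symmetric[of 7 2]
    skew_symmetric[of 2 4] skew_symmetric[of 6 3] low_weights assms
  by (simp add: algebra_simps power2_eq_square)

lemma relation11:
  assumes "11 \<le> N"
  shows "c 5 6 * (2 * c 2 3 - c 3 4 - c 4 5) = 4 * c 3 4 * c 4 5 - 6 * (c 4 5)^2"
  using jacobi[of 2 4 5] skew_symmetric[of 6 5] skew_symmetric[of 9 2]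
    skew_symmetric[of 5 2] skew_symmetric[of 7 4] low_weights assms
  by (simp add: algebra_simps power2_eq_square)

lemma relation12:
  assumes "12 \<le> N"
  shows "3 * c 5 6 * (c 3 4 + c 4 5) = 4 * (c 4 5)^2"
  using jacobi[of 3 4 5] skew_symmetric[of 7 5] skew_symmetric[of 9 3]
    skew_symmetric[of 5 3] skew_symmetric[of 8 4] low_weights assms
  by (simp add: algebra_simps power2_eq_square)

lemma witt_ratio:
  assumes "12 \<le> N" "c 3 4 \<noteq> 0"
  shows "c 2 3 = 10 * c 3 4"
proof -
  define a b d e where "a = c 2 3" and "b = c 3 4" and "d = c 4 5" and "e = c 5 6"
  have r: "d * (2 * a + b) = 3 * b^2" "e * (2 * a - b - d) = 4 * b * d - 6 * d^2"
    "3 * e * (b + d) = 4 * d^2"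
    using relation9 relation11 relation12 assms by (simp_all add: a_def b_def d_def e_def)
  have "b \<noteq> 0" using assms by (simp add: b_def)
  then have "d \<noteq> 0" using r(1) by auto
  \<comment> \<open>Elimination of \<open>e\<close>: the second relation is multiplied by
    \<open>3 * (b + d)\<close> and \<open>3 * e * (b + d)\<close> replaced by means of the third.
    After division by \<open>d\<close> the first relation cancels the terms in
    \<open>b^2\<close>.\<close>
  have "4 * d^2 * (2 * a - b - d) = 3 * (b + d) * (4 * b * d - 6 * d^2)"
    unfolding r(2,3)[symmetric] by simp
  then have "d * (4 * (d * (2 * a + b)) - 8 * b * d - 4 * d^2 - 3 * (b + d) * (4 * b - 6 * d)) = 0"
    by (simp add: algebra_simps power2_eq_square)
  then have "4 * (d * (2 * a + b)) - 8 * b * d - 4 * d^2 - 3 * (b + d) * (4 * b - 6 * d) = 0"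
    using \<open>d \<noteq> 0\<close> by simp
  then have "d * (7 * d - b) = 0"
    unfolding r(1) by (simp add: algebra_simps power2_eq_square)
  then have "b = 7 * d" using \<open>d \<noteq> 0\<close> by simp
  with r(1) have "d * (2 * a - 140 * d) = 0" by (simp add: algebra_simps power2_eq_square)
  then have "a = 10 * b" using \<open>d \<noteq> 0\<close> \<open>b = 7 * d\<close> by simp
  then show ?thesis by (simp add: a_def b_def)
qed

end

section \<open>Uniqueness from the two lowest constants, and the Witt solution\<close>

lemma leibniz_array_diff:
  assumes "leibniz_array c N" "leibniz_array f N"
  shows "leibniz_array (\<lambda>i j. c i j - f i j) N"
proof -
  interpret c: leibniz_array c N by fact
  interpret f: leibniz_array f N by fact
  show ?thesis
  proof
    show "c j i - f j i = - (c i j - f i j)" for i j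
      using c.skew_symmetric[of j i] f.skew_symmetric[of j i] by simp
    show "c (Suc i) j - f (Suc i) j + (c i (Suc j) - f i (Suc j)) = c i j - f i j"
      if "2 \<le> i" "2 \<le> j" "i + j < N" for i j
      using c.leibniz[OF that] f.leibniz[OF that] by simp
  qed
qed

text \<open>The structure constants of \<open>V\<^sub>n\<close> in the basis with \<open>e\<^sub>1\<close> kept and \<open>e\<^sub>i\<close> scaled by
  \<open>(i - 2)!\<close> for \<open>i \<ge> 2\<close>, which makes \<open>[e\<^sub>1, e\<^sub>i] = e\<^sub>i\<^sub>+\<^sub>1\<close>.\<close>

definition witt_coeff :: "nat \<Rightarrow> nat \<Rightarrow> real" where
  "witt_coeff i j = (real j - real i) * fact (i - 2) * fact (j - 2) / fact (i + j - 2)"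

lemma leibniz_array_witt: "leibniz_array (\<lambda>i j. a * witt_coeff i j) N"
proof
  show "a * witt_coeff j i = - (a * witt_coeff i j)" for i j
    by (simp add: witt_coeff_def add.commute minus_divide_left algebra_simps diff_divide_distrib)
  fix i j :: nat
  assume "2 \<le> i" "2 \<le> j"
  then obtain r s where rs: "i = r + 2" "j = s + 2"
    by (metis add.commute le_Suc_ex)
  have "witt_coeff (Suc i) j + witt_coeff i (Suc j) = witt_coeff i j"
  proof -
    define R S Q :: real where "R = fact r" and "S = fact s" and "Q = fact (r + s + 2)"
    have nz: "R \<noteq> 0" "S \<noteq> 0" "Q \<noteq> 0" by (simp_all add: R_def S_def Q_def)
    have *: "fact (Suc i - 2) = (real r + 1) * R" "fact (Suc j - 2) = (real s + 1) * S"
        "fact (Suc i + j - 2) = (real r + real s + 3) * Q" "fact (i + Suc j - 2) = (real r + real s + 3) * Q"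
        "fact (i - 2) = R" "fact (j - 2) = S" "fact (i + j - 2) = Q"
        "real j - real (Suc i) = real s - real r - 1" "real (Suc j) - real i = real s - real r + 1"
        "real j - real i = real s - real r"
      by (simp_all add: rs R_def S_def Q_def algebra_simps)
    have "real r + real s + 3 \<noteq> 0" by (simp add: add_nonneg_eq_0_iff)
    with nz show ?thesis
      unfolding witt_coeff_def * by (simp add: divide_simps) (simp add: algebra_simps)
  qed
  then show "a * witt_coeff (Suc i) j + a * witt_coeff i (Suc j) = a * witt_coeff i j"
    by (simp flip: distrib_left)
qed

lemma witt_coeff_numeral:
  "witt_coeff 2 3 = 1 / 6" "witt_coeff 3 4 = 1 / 60"
  by (simp_all add: witt_coeff_def fact_numeral)

text \<open>Weights 5 and 7 bring the constants \<open>c 2 3\<close> and \<open>c 3 4\<close>, for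
  which there is no Jacobi identity of the same weight; even weights bring none. An odd weight from
  9 on is \<open>2 + 3 + m\<close> with \<open>m \<ge> 4\<close>, so there an identity is
  available.\<close>

lemma weight_cases:
  fixes w :: nat
  shows "w \<le> 4 \<or> w = 5 \<or> w = 7 \<or> (\<exists>m. w = 2 * m + 2 \<and> 1 \<le> m) \<or> (\<exists>q. w = 2 * q + 1 \<and> 4 \<le> q)"
proof (cases "even w")
  case True
  then obtain m where "w = 2 * m" by (elim evenE)
  then have "w \<le> 4 \<or> w = 2 * (m - 1) + 2 \<and> 1 \<le> m - 1" by auto
  then show ?thesis by blast
next
  case False
  then obtain q where "w = 2 * q + 1" by (elim oddE)
  then have "w \<le> 4 \<or> w = 5 \<or> w = 7 \<or> w = 2 * q + 1 \<and> 4 \<le> q" by presburger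
  then show ?thesis by blast
qed

context graded_coeffs
begin

text \<open>At an odd weight two solutions of the Leibniz recursion that agree in all lower weights
  differ by an alternating sequence \<open>(-1)\<^sup>i \<delta>\<close>; the Jacobi identity for \<open>e\<^sub>2, e\<^sub>3, e\<^sub>m\<close> is then a
  linear equation for \<open>\<delta>\<close>.\<close>

lemma determined_by_lowest:
  fixes f :: "nat \<Rightarrow> nat \<Rightarrow> real"
  assumes f: "leibniz_array f N"
    and f_jacobi: "\<And>m. 4 \<le> m \<Longrightarrow> f 2 3 * f 5 m + f 3 m * f (m + 3) 2 + f m 2 * f (m + 2) 3 = 0"
    and f_nonzero: "\<And>m. 4 \<le> m \<Longrightarrow> f 2 3 + f 3 m + f 2 m \<noteq> 0"
    and start: "c 2 3 = f 2 3" "c 3 4 = f 3 4"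
    and ij: "2 \<le> i" "2 \<le> j" "i + j \<le> N"
  shows "c i j = f i j"
proof -
  define d where "d i j = c i j - f i j" for i j
  interpret f: leibniz_array f N by fact
  interpret d: leibniz_array d N
    unfolding d_def by (rule leibniz_array_diff) unfold_locales
  have d_start: "d 2 3 = 0" "d 3 4 = 0" using start by (simp_all add: d_def)
  have "d.vanishes_at w" if "w \<le> N" for w
    using that
  proof (induction w rule: less_induct)
    case (less w)
    consider "w \<le> 4" | "w = 5" | "w = 7" | m where "w = 2 * m + 2" "1 \<le> m" | q where "w = 2 * q + 1" "4 \<le> q"
      using weight_cases[of w] by blast
    then show ?case
    proof cases
      case 1
      then show ?thesis by (rule d.vanishes_at_small)
    next
      case 2
      then show ?thesis
        using d.vanishes_at_Suc[of 4 2 3] less.IH[of 4] less.prems d_start by simp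
    next
      case 3
      then show ?thesis
        using d.vanishes_at_Suc[of 6 3 4] less.IH[of 6] less.prems d_start by simp
    next
      case (4 m)
      then show ?thesis
        using d.vanishes_at_even[of m] less.IH[of "2 * m + 1"] less.prems by simp
    next
      case (5 q)
      \<comment> \<open>Since \<open>2 + 3 + m = w\<close>, the first factor of each product in the
        identity has lower weight and is known; only the second factors contain \<delta>. The parity
        of \<open>m\<close> fixes their signs.\<close>
      define m where "m = 2 * q - 4"
      have m: "4 \<le> m" "2 * q = m + 4" "w = m + 5" "even m" using 5 by (auto simp: m_def)
      have low: "d x y = 0" if "2 \<le> x" "2 \<le> y" "x + y \<le> m + 4" for x y
        by (rule d.vanishes_atD) (use that less m in auto)
      have c_low: "c x y = f x y" if "2 \<le> x" "2 \<le> y" "x + y \<le> m + 4" for x y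
        using low[OF that] by (simp add: d_def)
      define \<delta> where "\<delta> = d 2 (m + 3)"
      have alt: "d x y = (-1) ^ x * \<delta>" if "2 \<le> x" "2 \<le> y" "x + y = m + 5" for x y
        using d.alternating[of "m + 4" x y 2 "m + 3"] that less m by (auto simp: \<delta>_def)
      have ds: "d 5 m = - \<delta>" "d (m + 3) 2 = - \<delta>" "d (m + 2) 3 = \<delta>"
        using alt[of 5 m] alt[of "m + 3" 2] alt[of "m + 2" 3] m by auto
      have "c 2 3 = f 2 3" "c 3 m = f 3 m" "c m 2 = f m 2"
        "c 5 m = f 5 m - \<delta>" "c (m + 3) 2 = f (m + 3) 2 - \<delta>" "c (m + 2) 3 = f (m + 2) 3 + \<delta>"
        using c_low[of 2 3] c_low[of 3 m] c_low[of m 2] m ds by (auto simp: d_def)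
      moreover have "c 2 3 * c 5 m + c 3 m * c (m + 3) 2 + c m 2 * c (m + 2) 3 = 0"
        using jacobi[of 2 3 m] m less.prems by (simp add: add.commute)
      ultimately have "f 2 3 * (f 5 m - \<delta>) + f 3 m * (f (m + 3) 2 - \<delta>) + f m 2 * (f (m + 2) 3 + \<delta>) = 0"
        by (simp only:)
      then have "f 2 3 * f 5 m + f 3 m * f (m + 3) 2 + f m 2 * f (m + 2) 3
          - (f 2 3 + f 3 m + f 2 m) * \<delta> = 0"
        unfolding f.skew_symmetric[of m 2] by (simp only: algebra_simps)
      then have "\<delta> = 0"
        using f_jacobi[OF m(1)] f_nonzero[OF m(1)] by simp
      then show ?thesis
        using alt m by (auto simp: d.vanishes_at_def)
    qed
  qed
  then have "d.vanishes_at (i + j)" using ij by simp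
  then show ?thesis using ij d.vanishes_atD[of i j] by (simp add: d_def)
qed

text \<open>The comparison array \<open>f\<close> belongs to the algebra in which \<open>e_2\<close>
  sends each \<open>e_j\<close>, \<open>j \<ge> 3\<close>, to \<open>c 2 3\<close> times
  \<open>e_(j+2)\<close>, and \<open>e_3, e_4, ...\<close> span an abelian ideal.\<close>

lemma vanishes_from_three:
  assumes "c 2 3 \<noteq> 0" "c 3 4 = 0" "3 \<le> i" "3 \<le> j" "i + j \<le> N"
  shows "c i j = 0"
proof -
  define f where "f i j = (if 3 \<le> i \<and> j \<le> 2 then - c 2 3 else if i \<le> 2 \<and> 3 \<le> j then c 2 3 else 0)"
    for i j :: nat
  have "leibniz_array f N"
    by unfold_locales (auto simp: f_def)
  then have "c i j = f i j"
    by (rule determined_by_lowest) (use assms in \<open>auto simp: f_def\<close>)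
  then show ?thesis using assms by (auto simp: f_def)
qed

text \<open>Uniqueness applies because the coefficient of \<delta> is a nonzero multiple of a sum of
  three positive Witt coefficients. The factor 6 is the inverse of
  \<open>witt_coeff 2 3\<close>.\<close>

lemma witt_unique:
  assumes "c 3 4 \<noteq> 0" "c 2 3 = 10 * c 3 4" "2 \<le> i" "2 \<le> j" "i + j \<le> N"
  shows "c i j = 6 * c 2 3 * witt_coeff i j"
proof (rule determined_by_lowest[where f = "\<lambda>i j. 6 * c 2 3 * witt_coeff i j", OF _ _ _ _ _ assms(3-5)])
  show "leibniz_array (\<lambda>i j. 6 * c 2 3 * witt_coeff i j) N"
    by (rule leibniz_array_witt)
  show "c 2 3 = 6 * c 2 3 * witt_coeff 2 3" "c 3 4 = 6 * c 2 3 * witt_coeff 3 4"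
    using assms by (simp_all add: witt_coeff_numeral)
  fix m :: nat
  assume "4 \<le> m"
  then obtain r where r: "m = r + 4"
    by (metis add.commute le_Suc_ex)
  have "witt_coeff 2 3 * witt_coeff 5 m + witt_coeff 3 m * witt_coeff (m + 3) 2 +
      witt_coeff m 2 * witt_coeff (m + 2) 3 = 0"
  proof -
    \<comment> \<open>Every factorial that involves \<open>m\<close> is a polynomial multiple of
      \<open>R\<close>, which leaves a polynomial identity in \<open>r\<close>.\<close>
    define R Q :: real where "R = fact (r + 2)" and "Q = fact (r + 4)"
    have Q: "Q = (real r + 4) * (real r + 3) * R"
      by (simp add: Q_def R_def numeral_eq_Suc algebra_simps)
    have *: "fact (m - 2) = R" "fact (m + 3 - 2) = (real r + 5) * Q" "fact (m + 2 - 2) = Q"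
        "fact (5 + m - 2) = (real r + 7) * ((real r + 6) * ((real r + 5) * Q))"
        "fact (3 + m - 2) = (real r + 5) * Q" "fact (m + 2 - 2) = Q"
        "fact (m + 3 + 2 - 2) = (real r + 7) * ((real r + 6) * ((real r + 5) * Q))"
        "fact (m + 2 + 3 - 2) = (real r + 7) * ((real r + 6) * ((real r + 5) * Q))"
        "real 2 - real m = - real r - 2" "real 2 - real (m + 3) = - real r - 5"
        "real 3 - real (m + 2) = - real r - 3" "real m - real 5 = real r - 1"
        "real m - real 3 = real r + 1" "real 3 - real 2 = 1"
        "(fact (5 - 2) :: real) = 6" "(fact (3 - 2) :: real) = 1"
        "(fact (2 - 2) :: real) = 1" "(fact (2 + 3 - 2) :: real) = 6"
      by (simp_all add: r R_def Q_def numeral_eq_Suc algebra_simps)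
    have "R \<noteq> 0" "real r + 3 \<noteq> 0" "real r + 4 \<noteq> 0" "real r + 5 \<noteq> 0" "real r + 6 \<noteq> 0" "real r + 7 \<noteq> 0"
      by (simp_all add: R_def add_nonneg_eq_0_iff)
    then show ?thesis
      unfolding witt_coeff_def * unfolding Q by (simp add: divide_simps) (simp add: algebra_simps)
  qed
  then have "(6 * c 2 3)^2 * (witt_coeff 2 3 * witt_coeff 5 m + witt_coeff 3 m * witt_coeff (m + 3) 2 +
      witt_coeff m 2 * witt_coeff (m + 2) 3) = 0" by simp
  then show "6 * c 2 3 * witt_coeff 2 3 * (6 * c 2 3 * witt_coeff 5 m) +
    6 * c 2 3 * witt_coeff 3 m * (6 * c 2 3 * witt_coeff (m + 3) 2) +
    6 * c 2 3 * witt_coeff m 2 * (6 * c 2 3 * witt_coeff (m + 2) 3) = 0"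
    by (simp add: power2_eq_square algebra_simps)
  have "0 < witt_coeff 2 3" "0 < witt_coeff 3 m" "0 < witt_coeff 2 m"
    using \<open>4 \<le> m\<close> by (auto simp: witt_coeff_def)
  then have "6 * c 2 3 * (witt_coeff 2 3 + witt_coeff 3 m + witt_coeff 2 m) \<noteq> 0"
    using assms by simp
  then show "6 * c 2 3 * witt_coeff 2 3 + 6 * c 2 3 * witt_coeff 3 m + 6 * c 2 3 * witt_coeff 2 m \<noteq> 0"
    by (simp add: distrib_left)
qed

text \<open>Let \<delta> be \<open>c p (Suc p)\<close>. Up to sign, the entries of weights
  \<open>2 * p + 1\<close> to \<open>2 * p + 4\<close> are polynomials in \<open>i\<close> of degree
  0, 1, 2, 3, each obtained by summing the one before. As the boundary values at
  \<open>i = 2\<close> in the last two weights vanish, the cubic grows from 2 to the middle by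
  nonnegative multiples of \<delta>, not all zero, whereas skew symmetry makes its middle value
  zero.\<close>

lemma leading_coeff_zero:
  assumes p: "4 \<le> p" "2 * p + 5 \<le> N" and low: "\<And>w. w \<le> 2 * p \<Longrightarrow> vanishes_at w"
    and c2: "c 2 (2 * p + 1) = 0"
  shows "c p (Suc p) = 0"
proof (rule ccontr)
  define \<delta> where "\<delta> = c p (Suc p)"
  assume "c p (Suc p) \<noteq> 0"
  then have \<delta>: "\<delta> \<noteq> 0" by (simp add: \<delta>_def)
  have zero: "c i j = 0" if "2 \<le> i" "2 \<le> j" "i + j \<le> 2 * p" for i j
    by (rule vanishes_atD) (use that low in auto)
  have sum: "p + Suc p = 2 * p + 1" by simp
  \<comment> \<open>By \<open>4 \<le> p\<close> the other two products each have a factor of weight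
    at most \<open>2 * p\<close>.\<close>
  have "c p (Suc p) * c (2 * p + 1) 3 = 0"
    using jacobi[of 3 p "Suc p", unfolded sum] zero[of 3 p] zero[of "Suc p" 3] p by simp
  then have c3: "c 3 (2 * p + 1) = 0"
    using \<delta> skew_symmetric[of "2 * p + 1" 3] by (simp add: \<delta>_def)
  define g where "g i = (-1) ^ (i + p) * c i (2 * p + 3 - i)" for i
  define h where "h i = g i + \<delta> * ((real i - 2) * (2 * real p + 1 - real i) / 2)" for i
  have third: "g i = - (\<delta> * ((real i - 2) * (2 * real p + 1 - real i) / 2))" if "2 \<le> i" "i \<le> 2 * p + 1" for i
  proof -
    have "h i = h 2"
    proof (rule constant_from[where g = h, OF _ that])
      fix i assume i: "2 \<le> i" "i < 2 * p + 1"
      have "c (Suc i) (2 * p + 2 - i) + c i (Suc (2 * p + 2 - i)) = c i (2 * p + 2 - i)"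
        by (rule leibniz) (use i p in auto)
      also have "\<dots> = (-1) ^ (i + p) * (real p + 1 - real i) * \<delta>"
        unfolding \<delta>_def by (rule second_weight) (use i p low in auto)
      finally have "(-1) ^ (i + p) * (c (Suc i) (2 * p + 2 - i) + c i (2 * p + 3 - i)) = (real p + 1 - real i) * \<delta>"
        using i by (simp add: Suc_diff_le numeral_3_eq_3 flip: power_add mult.assoc)
      moreover have "2 * p + 3 - Suc i = 2 * p + 2 - i" using i by simp
      ultimately have "g i - g (Suc i) = (real p + 1 - real i) * \<delta>"
        by (simp add: g_def algebra_simps)
      moreover have "h (Suc i) - h i = g (Suc i) - g i + (real p + 1 - real i) * \<delta>"
        by (simp add: h_def field_simps)
      ultimately show "h (Suc i) = h i" by simp
    qed
    also have "h 2 = 0" using c2 by (simp add: h_def g_def)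
    finally show ?thesis by (simp add: h_def)
  qed
  define v where "v i = (-1) ^ (i + p) * c i (2 * p + 4 - i)" for i
  define T :: "nat \<Rightarrow> real" where "T i = (\<Sum>s=2..<i. (real s - 2) * (2 * real p + 1 - real s) / 2)" for i
  have fourth: "v i = \<delta> * T i" if "2 \<le> i" "i \<le> p + 2" for i
    using that
  proof (induction i rule: nat_induct_at_least)
    case base
    have "c 2 (2 * p + 2) = 0"
      using leibniz[of 2 "2 * p + 1"] c2 c3 p by simp
    then show ?case by (simp add: v_def T_def)
  next
    case (Suc i)
    have "c (Suc i) (2 * p + 3 - i) + c i (Suc (2 * p + 3 - i)) = c i (2 * p + 3 - i)"
      by (rule leibniz) (use Suc p in auto)
    moreover have "2 * p + 4 - Suc i = 2 * p + 3 - i" "Suc (2 * p + 3 - i) = 2 * p + 4 - i"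
      using Suc by simp_all
    ultimately have "v i - v (Suc i) = g i"
      by (simp add: v_def g_def algebra_simps flip: distrib_left)
    then show ?case
      using Suc third[of i] p by (simp add: T_def distrib_left)
  qed
  have "0 < T (p + 2)"
    unfolding T_def
    by (rule sum_pos2[of _ 3]) (use p in \<open>auto intro!: mult_nonneg_nonneg\<close>)
  then have "v (p + 2) \<noteq> 0"
    using fourth[of "p + 2"] \<delta> by simp
  then show False
    using diagonal_zero[of "p + 2"] by (simp add: v_def)
qed

text \<open>In weight \<open>2 * p + 1\<close> the identity of \<open>e_2\<close>,
  \<open>e_p\<close>, \<open>e_(p+1)\<close> collapses to one product, so the leading constant or
  \<open>c 2 (2 * p + 1)\<close> is zero. For \<open>p = k - 1\<close> the latter contradicts
  \<open>top\<close>; for smaller \<open>p\<close> there is room for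
  \<open>leading_coeff_zero\<close>.\<close>

lemma vanishes_below:
  assumes N: "N = 2 * k + 1" and top: "c 2 (2 * k - 1) \<noteq> 0"
    and start: "c 2 3 = 0" "c 3 4 = 0" and w: "w \<le> 2 * k"
  shows "vanishes_at w"
  using w
proof (induction w rule: less_induct)
  case (less w)
  consider "w \<le> 4" | "w = 5" | "w = 7" | m where "w = 2 * m + 2" "1 \<le> m" | p where "w = 2 * p + 1" "4 \<le> p"
    using weight_cases[of w] by blast
  then show ?case
  proof cases
    case 1
    then show ?thesis by (rule vanishes_at_small)
  next
    case 2
    then show ?thesis
      using vanishes_at_Suc[of 4 2 3] less.IH[of 4] less.prems start N by simp
  next
    case 3
    then show ?thesis
      using vanishes_at_Suc[of 6 3 4] less.IH[of 6] less.prems start N by simp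
  next
    case (4 m)
    then show ?thesis
      using vanishes_at_even[of m] less.IH[of "2 * m + 1"] less.prems N by simp
  next
    case (5 p)
    have low: "vanishes_at x" if "x \<le> 2 * p" for x
      using less that 5 by simp
    have zero: "c i j = 0" if "2 \<le> i" "2 \<le> j" "i + j \<le> 2 * p" for i j
      by (rule vanishes_atD) (use that low in auto)
    have sum: "p + Suc p = 2 * p + 1" by simp
    have "2 + p + Suc p \<le> N" using 5 less.prems N by presburger
    then have "c p (Suc p) * c (2 * p + 1) 2 = 0"
      using jacobi[of 2 p "Suc p", unfolded sum] zero[of 2 p] zero[of "Suc p" 2] 5 less.prems N by simp
    then have or: "c p (Suc p) = 0 \<or> c 2 (2 * p + 1) = 0"
      using skew_symmetric[of "2 * p + 1" 2] by auto
    have "c p (Suc p) = 0"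
    proof (cases "k = p + 1")
      case True
      then show ?thesis using or top by simp
    next
      case False
      then have "2 * p + 5 \<le> N" using less.prems 5 N by simp
      then show ?thesis using or leading_coeff_zero[OF \<open>4 \<le> p\<close> _ low] by blast
    qed
    then show ?thesis
      using vanishes_at_Suc[OF low, of "2 * p" p "Suc p"] 5 less.prems N by simp
  qed
qed

lemma classification:
  assumes N: "N = 2 * k + 1" and k: "2 \<le> k"
    and nondegenerate: "\<And>i. 2 \<le> i \<Longrightarrow> i \<le> 2 * k - 1 \<Longrightarrow> c i (2 * k + 1 - i) \<noteq> 0"
  obtains (m0) "\<And>i j. 2 \<le> i \<Longrightarrow> 2 \<le> j \<Longrightarrow> i + j \<le> 2 * k \<Longrightarrow> c i j = 0"
  | (V6) "k = 3" "c 2 3 \<noteq> 0"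
  | (V) "6 \<le> k" "c 2 3 \<noteq> 0" "\<And>i j. 2 \<le> i \<Longrightarrow> 2 \<le> j \<Longrightarrow> i + j \<le> 2 * k \<Longrightarrow> c i j = 6 * c 2 3 * witt_coeff i j"
  | (g8) "k = 4" "c 3 4 \<noteq> 0"
  | (g10) "k = 5" "c 3 4 \<noteq> 0"
proof -
  have m0: "c i j = 0" if "2 \<le> i" "2 \<le> j" "i + j \<le> 2 * k" "c 2 3 = 0" "c 3 4 = 0" for i j
    by (rule vanishes_atD[OF vanishes_below[OF N]]) (use that k nondegenerate[of 2] in auto)
  consider "k = 2" | "k = 3" | "4 \<le> k" using k by linarith
  then show thesis
  proof cases
    case 1
    have "vanishes_at w" if "w \<le> 4" for w by (rule vanishes_at_small[OF that])
    then show ?thesis using 1 by (intro that(1)) (auto intro: vanishes_atD)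
  next
    case 2
    show ?thesis
    proof (cases "c 2 3 = 0")
      case True
      have "vanishes_at 5"
        using vanishes_at_Suc[of 4 2 3] vanishes_at_small[of 4] N 2 True by simp
      then have "vanishes_at 6"
        using vanishes_at_even[of 2] N 2 by simp
      have "vanishes_at w" if "w \<le> 6" for w
      proof -
        have "w \<le> 4 \<or> w = 5 \<or> w = 6" using that by auto
        then show ?thesis using vanishes_at_small \<open>vanishes_at 5\<close> \<open>vanishes_at 6\<close> by auto
      qed
      then show ?thesis using 2 by (intro that(1)) (auto intro: vanishes_atD)
    next
      case False
      then show ?thesis using 2 that(2) by blast
    qed
  next
    case 3
    show ?thesis
    proof (cases "c 3 4 = 0")
      case True
      have "c 2 3 = 0"
      proof (rule ccontr)
        assume "c 2 3 \<noteq> 0"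
        \<comment> \<open>The middle entry of the top weight would fall into the vanishing block of
          \<open>vanishes_from_three\<close>.\<close>
        then have "c k (k + 1) = 0"
          by (rule vanishes_from_three) (use True 3 N in auto)
        moreover have "2 * k + 1 - k = k + 1" "k \<le> 2 * k - 1" using 3 by auto
        ultimately show False using nondegenerate[of k] 3 by simp
      qed
      then show ?thesis using that(1) m0 True by blast
    next
      case False
      consider "k = 4" | "k = 5" | "6 \<le> k" using 3 by linarith
      then show ?thesis
      proof cases
        case 1
        then show ?thesis using that(4) False by blast
      next
        case 2
        then show ?thesis using that(5) False by blast
      next
        case 3
        have ratio: "c 2 3 = 10 * c 3 4" using witt_ratio False N 3 by simp
        show ?thesis
        proof (rule that(3)[OF 3])
          show "c 2 3 \<noteq> 0" using ratio False by simp
          show "c i j = 6 * c 2 3 * witt_coeff i j" if "2 \<le> i" "2 \<le> j" "i + j \<le> 2 * k" for i j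
            by (rule witt_unique[OF False ratio]) (use that N in auto)
        qed
      qed
    qed
  qed
qed

end

section \<open>Coordinates with respect to a basis\<close>

lemma alternating_skew:
  assumes "bilinear B" "\<And>x. B x x = 0"
  shows "B y x = - B x y"
proof -
  have "B x x + B x y + (B y x + B y y) = 0"
    using assms(2)[of "x + y"] by (simp only: bilinear_ladd[OF assms(1)] bilinear_radd[OF assms(1)] add_ac)
  then have "B x y + B y x = 0" by (simp add: assms(2))
  then show ?thesis by (metis add.inverse_unique)
qed

locale basis_family =
  fixes n :: nat and e :: "nat \<Rightarrow> 'a::real_vector"
  assumes basis: "is_basis n e"
begin

abbreviation co :: "nat \<Rightarrow> 'a \<Rightarrow> real" where "co \<equiv> dual_basis n e"

lemma independent_basis: "independent (e ` {1..n})" and span_basis: "span (e ` {1..n}) = UNIV"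
  and inj_basis: "inj_on e {1..n}"
  using basis by (auto simp: is_basis_def)

lemma in_span [simp]: "x \<in> span (e ` {Suc 0..n})"
  using span_basis by simp

lemma linear_co: "linear (co i)"
proof (rule linearI)
  show "co i (x + y) = co i x + co i y" for x y
    unfolding dual_basis_def
    by (subst real_vector.representation_add[OF independent_basis]) auto
  show "co i (r *\<^sub>R x) = r *\<^sub>R co i x" for r x
    unfolding dual_basis_def
    by (subst real_vector.representation_scale[OF independent_basis]) auto
qed

lemmas co_add = linear_add[OF linear_co] and co_scaleR = linear_scale[OF linear_co]
  and co_sum = linear_sum[OF linear_co] and co_zero = linear_0[OF linear_co]
  and co_minus = linear_neg[OF linear_co] and co_diff = linear_diff[OF linear_co]

lemma co_basis: "i \<in> {1..n} \<Longrightarrow> j \<in> {1..n} \<Longrightarrow> co i (e j) = (if i = j then 1 else 0)"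
  unfolding dual_basis_def
  using real_vector.representation_basis[OF independent_basis, of "e j"] inj_basis
  by (auto dest: inj_onD)

lemma expansion: "(\<Sum>i=1..n. co i x *\<^sub>R e i) = x"
proof -
  have "x = (\<Sum>b\<in>e ` {1..n}. representation (e ` {1..n}) x b *\<^sub>R b)"
    by (rule real_vector.sum_representation_eq[OF independent_basis, symmetric]) auto
  also have "\<dots> = (\<Sum>i=1..n. co i x *\<^sub>R e i)"
    by (subst sum.reindex[OF inj_basis]) (simp add: dual_basis_def)
  finally show ?thesis by simp
qed

lemma co_eqI: "(\<And>i. i \<in> {1..n} \<Longrightarrow> co i x = co i y) \<Longrightarrow> x = y"
  using expansion[of x] expansion[of y] by (metis (no_types, lifting) sum.cong)

lemma linear_eq_basis:
  assumes "linear f" "linear g" "\<And>i. i \<in> {1..n} \<Longrightarrow> f (e i) = g (e i)"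
  shows "f x = g x"
  by (rule linear_eq_on[OF assms(1,2), of x "e ` {1..n}"]) (use assms(3) in auto)

lemma bilinear_eq_basis:
  assumes "bilinear f" "bilinear g" "\<And>i j. i \<in> {1..n} \<Longrightarrow> j \<in> {1..n} \<Longrightarrow> f (e i) (e j) = g (e i) (e j)"
  shows "f x y = g x y"
  by (rule bilinear_eq[OF assms(1,2), of UNIV "e ` {1..n}" UNIV "e ` {1..n}"])
    (use assms(3) in auto)

lemma trilinear_zero_basis:
  fixes T :: "'a \<Rightarrow> 'a \<Rightarrow> 'a \<Rightarrow> 'b::real_vector"
  assumes "\<And>y z. linear (\<lambda>x. T x y z)" "\<And>x z. linear (\<lambda>y. T x y z)" "\<And>x y. linear (\<lambda>z. T x y z)"
    and "\<And>i j l. i \<in> {1..n} \<Longrightarrow> j \<in> {1..n} \<Longrightarrow> l \<in> {1..n} \<Longrightarrow> T (e i) (e j) (e l) = 0"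
  shows "T x y z = 0"
proof -
  have zero: "linear (\<lambda>x. 0 :: 'b)" by (simp add: linear_iff)
  have "T (e i) (e j) z = 0" if "i \<in> {1..n}" "j \<in> {1..n}" for i j z
    by (rule linear_eq_basis[OF assms(3) zero]) (use assms(4) that in blast)
  then have "T (e i) y z = 0" if "i \<in> {1..n}" for i y z
    by (rule linear_eq_basis[OF assms(2) zero]) (use that in blast)
  then show ?thesis
    by (rule linear_eq_basis[OF assms(1) zero])
qed

lemma filtration_subspace: "subspace (filtration n e p)"
  by (simp add: filtration_def)

lemma filtration_antimono: "p \<le> q \<Longrightarrow> filtration n e q \<subseteq> filtration n e p"
  unfolding filtration_def by (intro span_mono image_mono) auto

lemma basis_in_filtration: "p \<le> i \<Longrightarrow> i \<le> n \<Longrightarrow> e i \<in> filtration n e p"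
  unfolding filtration_def by (intro span_base imageI) auto

lemma filtration_top: "n < p \<Longrightarrow> filtration n e p = {0}"
  by (simp add: filtration_def)

lemma filtration_one: "p \<le> 1 \<Longrightarrow> filtration n e p = UNIV"
  using filtration_antimono[of p 1] span_basis by (auto simp: filtration_def)

lemma filtration_iff:
  assumes "1 \<le> p"
  shows "x \<in> filtration n e p \<longleftrightarrow> (\<forall>i\<in>{1..n}. i < p \<longrightarrow> co i x = 0)"
proof
  assume "x \<in> filtration n e p"
  then have x: "x \<in> span (e ` {p..n})" by (simp add: filtration_def)
  show "\<forall>i\<in>{1..n}. i < p \<longrightarrow> co i x = 0"
  proof (intro ballI impI)
    fix i assume i: "i \<in> {1..n}" "i < p"
    have "linear (\<lambda>x. 0 :: real)" by (simp add: linear_iff)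
    then show "co i x = 0"
      by (rule linear_eq_on[OF linear_co _ x]) (use i assms in \<open>auto simp: co_basis\<close>)
  qed
next
  assume zero: "\<forall>i\<in>{1..n}. i < p \<longrightarrow> co i x = 0"
  have "(\<Sum>i=1..n. co i x *\<^sub>R e i) \<in> filtration n e p"
  proof (rule subspace_sum[OF filtration_subspace])
    fix i assume "i \<in> {1..n}"
    then show "co i x *\<^sub>R e i \<in> filtration n e p"
      using zero subspace_0[OF filtration_subspace, of p]
        subspace_scale[OF filtration_subspace basis_in_filtration[of p i]] by (cases "i < p") auto
  qed
  then show "x \<in> filtration n e p" by (simp only: expansion)
qed

lemma bilinear_expansion:
  assumes "bilinear B"
  shows "B x y = (\<Sum>i=1..n. \<Sum>j=1..n. (co i x * co j y) *\<^sub>R B (e i) (e j))"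
proof -
  have "B (\<Sum>i=1..n. co i x *\<^sub>R e i) (\<Sum>j=1..n. co j y *\<^sub>R e j)
      = (\<Sum>i=1..n. \<Sum>j=1..n. (co i x * co j y) *\<^sub>R B (e i) (e j))"
    by (simp add: bilinear_sum[OF assms] sum.cartesian_product bilinear_lmul[OF assms] bilinear_rmul[OF assms]
        split_def mult.commute)
  then show ?thesis by (simp only: expansion)
qed

text \<open>Among the pairs with \<open>i \<ge> p\<close> and \<open>j \<ge> q\<close> only
  \<open>(p, q)\<close> has sum \<open>p + q\<close>, and on the others \<open>B\<close> is zero.
  This is how identities of the algebra and of the form pass to leading coefficients.\<close>

lemma bilinear_leading:
  fixes B :: "'a \<Rightarrow> 'a \<Rightarrow> real"
  assumes B: "bilinear B" and pq: "p \<in> {1..n}" "q \<in> {1..n}"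
    and xy: "x \<in> filtration n e p" "y \<in> filtration n e q"
    and zero: "\<And>i j. p \<le> i \<Longrightarrow> i \<le> n \<Longrightarrow> q \<le> j \<Longrightarrow> j \<le> n \<Longrightarrow> p + q < i + j \<Longrightarrow> B (e i) (e j) = 0"
  shows "B x y = co p x * co q y * B (e p) (e q)"
proof -
  have "(co i x * co j y) *\<^sub>R B (e i) (e j)
      = (if i = p then if j = q then co p x * co q y * B (e p) (e q) else 0 else 0)"
    if "i \<in> {1..n}" "j \<in> {1..n}" for i j
  proof (cases "i < p \<or> j < q")
    case True
    then show ?thesis
      using xy that pq by (auto simp: filtration_iff)
  next
    case False
    then show ?thesis using zero[of i j] that by auto
  qed
  then have "B x y = (\<Sum>i=1..n. \<Sum>j=1..n. if i = p then if j = q then co p x * co q y * B (e p) (e q) else 0 else 0)"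
    unfolding bilinear_expansion[OF B, of x y] by (intro sum.cong refl) blast
  also have "\<dots> = (\<Sum>i=1..n. if i = p then \<Sum>j=1..n. if j = q then co p x * co q y * B (e p) (e q) else 0 else 0)"
    by (intro sum.cong refl) simp
  also have "\<dots> = co p x * co q y * B (e p) (e q)"
    using pq by (simp add: sum.delta)
  finally show ?thesis .
qed

lemma bilinear_filtered:
  assumes B: "bilinear B" and S: "subspace S"
    and xy: "x \<in> filtration n e p" "y \<in> filtration n e q"
    and sub: "\<And>i j. p \<le> i \<Longrightarrow> i \<le> n \<Longrightarrow> q \<le> j \<Longrightarrow> j \<le> n \<Longrightarrow> B (e i) (e j) \<in> S"
  shows "B x y \<in> S"
proof -
  have left: "B (e i) y \<in> S" if "p \<le> i" "i \<le> n" for i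
  proof -
    have "linear (B (e i))" using B by (simp add: bilinear_def)
    then have "subspace {y. B (e i) y \<in> S}"
      using linear_subspace_vimage[OF _ S] by (simp add: vimage_def)
    moreover have "e ` {q..n} \<subseteq> {y. B (e i) y \<in> S}" using sub that by auto
    ultimately show ?thesis
      using span_minimal[of "e ` {q..n}"] xy(2) by (auto simp: filtration_def)
  qed
  have "linear (\<lambda>x. B x y)" using B by (simp add: bilinear_def)
  then have "subspace {x. B x y \<in> S}"
    using linear_subspace_vimage[OF _ S, of "\<lambda>x. B x y"] by (simp add: vimage_def)
  moreover have "e ` {p..n} \<subseteq> {x. B x y \<in> S}" using left by auto
  ultimately show ?thesis
    using span_minimal[of "e ` {p..n}"] xy(1) by (auto simp: filtration_def)
qed

lemma bilinear_graded_bracket: "bilinear (graded_bracket n e c)"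
proof -
  define t where "t i j = (if i + j \<le> n then c i j *\<^sub>R e (i + j) else 0)" for i j
  have *: "graded_bracket n e c x y = (\<Sum>i=1..n. \<Sum>j=1..n. (co i x * co j y) *\<^sub>R t i j)" for x y
    unfolding graded_bracket_def t_def by (intro sum.cong refl) simp
  show ?thesis
    unfolding bilinear_def linear_iff *
    by (simp add: co_add co_scaleR distrib_left distrib_right scaleR_add_left sum.distrib scaleR_sum_right mult_ac)
qed

lemma graded_bracket_basis:
  assumes "i \<in> {1..n}" "j \<in> {1..n}"
  shows "graded_bracket n e c (e i) (e j) = (if i + j \<le> n then c i j *\<^sub>R e (i + j) else 0)"
proof -
  have "graded_bracket n e c (e i) (e j)
      = (\<Sum>i'=1..n. if i' = i then \<Sum>j'=1..n. if j' = j then if i + j \<le> n then c i j *\<^sub>R e (i + j) else 0 else 0 else 0)"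
    unfolding graded_bracket_def
  proof (intro sum.cong refl)
    fix i' assume i': "i' \<in> {1..n}"
    show "(\<Sum>j'=1..n. if i' + j' \<le> n then (co i' (e i) * co j' (e j) * c i' j') *\<^sub>R e (i' + j') else 0)
      = (if i' = i then \<Sum>j'=1..n. if j' = j then if i + j \<le> n then c i j *\<^sub>R e (i + j) else 0 else 0 else 0)"
    proof (cases "i' = i")
      case True
      then show ?thesis
        unfolding True if_P[OF refl] by (intro sum.cong refl) (use assms in \<open>auto simp: co_basis\<close>)
    next
      case False
      then have "co i' (e i) = 0" using co_basis[OF i' assms(1)] by simp
      then show ?thesis using False by (auto intro!: sum.neutral)
    qed
  qed
  also have "\<dots> = (if i + j \<le> n then c i j *\<^sub>R e (i + j) else 0)"
    using assms by (simp add: sum.delta)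
  finally show ?thesis .
qed

text \<open>The map multiplies \<open>e i\<close> by \<open>s i\<close>. As the models live on the
  same basis, such diagonal maps are enough to recognise them.\<close>

lemma graded_bracket_isomorphic:
  assumes s: "\<And>i. i \<in> {1..n} \<Longrightarrow> s i \<noteq> 0"
    and c: "\<And>i j. 1 \<le> i \<Longrightarrow> 1 \<le> j \<Longrightarrow> i + j \<le> n \<Longrightarrow> s (i + j) * c i j = s i * s j * c' i j"
  shows "lie_isomorphic (graded_bracket n e c) (graded_bracket n e c')"
proof -
  define scale where "scale t x = (\<Sum>i=1..n. (t i * co i x) *\<^sub>R e i)" for t x
  have lin: "linear (scale t)" for t
    by (rule linearI) (simp_all add: scale_def co_add co_scaleR distrib_left scaleR_add_left sum.distrib scaleR_sum_right mult_ac)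
  have scale_basis: "scale t (e i) = t i *\<^sub>R e i" if i: "i \<in> {1..n}" for t i
  proof -
    have "scale t (e i) = (\<Sum>j=1..n. if j = i then t i *\<^sub>R e i else 0)"
      unfolding scale_def by (intro sum.cong refl) (use i in \<open>auto simp: co_basis\<close>)
    then show ?thesis using i by simp
  qed
  have inverse: "scale t (scale u x) = x" if "\<And>i. i \<in> {1..n} \<Longrightarrow> t i * u i = 1" for t u x
    by (rule linear_eq_basis[OF linear_compose[OF lin lin, unfolded o_def] linear_id[unfolded id_def]])
      (use that in \<open>simp add: scale_basis linear_scale[OF lin] mult.commute\<close>)
  have "bij (scale s)"
    by (rule o_bij[where g = "scale (\<lambda>i. 1 / s i)"]) (auto simp: fun_eq_iff s intro!: inverse)
  moreover have "scale s (graded_bracket n e c x y) = graded_bracket n e c' (scale s x) (scale s y)" for x y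
  proof (rule bilinear_eq_basis[of "\<lambda>x y. scale s (graded_bracket n e c x y)" "\<lambda>x y. graded_bracket n e c' (scale s x) (scale s y)"])
    show "bilinear (\<lambda>x y. scale s (graded_bracket n e c x y))"
      "bilinear (\<lambda>x y. graded_bracket n e c' (scale s x) (scale s y))"
      using lin[of s] bilinear_graded_bracket[of c] bilinear_graded_bracket[of c']
      by (auto simp: bilinear_def linear_iff)
    fix i j assume ij: "i \<in> {1..n}" "j \<in> {1..n}"
    show "scale s (graded_bracket n e c (e i) (e j)) = graded_bracket n e c' (scale s (e i)) (scale s (e j))"
      using ij c[of i j]
      by (simp add: graded_bracket_basis scale_basis bilinear_lmul[OF bilinear_graded_bracket]
          bilinear_rmul[OF bilinear_graded_bracket] linear_scale[OF lin] linear_0[OF lin] mult_ac)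
  qed
  ultimately show ?thesis
    unfolding lie_isomorphic_def using lin by blast
qed

end

lemma symplectic_isomorphic:
  fixes br :: "'a::real_vector \<Rightarrow> 'a \<Rightarrow> 'a" and br' :: "'b::real_vector \<Rightarrow> 'b \<Rightarrow> 'b"
  assumes "lie_isomorphic br br'" "symplectic br"
  shows "symplectic br'"
proof -
  from assms(1) obtain \<phi> where \<phi>: "linear \<phi>" "bij \<phi>" and hom: "\<And>x y. \<phi> (br x y) = br' (\<phi> x) (\<phi> y)"
    by (auto simp: lie_isomorphic_def)
  from assms(2) obtain \<omega> where \<omega>: "symplectic_form br \<omega>"
    by (auto simp: symplectic_def)
  define \<psi> where "\<psi> = inv \<phi>"
  have \<psi>\<phi>: "\<psi> (\<phi> x) = x" "\<phi> (\<psi> y) = y" for x y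
    using \<phi>(2) by (simp_all add: \<psi>_def bij_is_inj bij_is_surj surj_f_inv_f)
  have lin: "linear \<psi>"
  proof (rule linearI)
    show "\<psi> (x + y) = \<psi> x + \<psi> y" for x y
      using \<psi>\<phi>(1)[of "\<psi> x + \<psi> y"] by (simp add: linear_add[OF \<phi>(1)] \<psi>\<phi>)
    show "\<psi> (r *\<^sub>R x) = r *\<^sub>R \<psi> x" for r x
      using \<psi>\<phi>(1)[of "r *\<^sub>R \<psi> x"] by (simp add: linear_scale[OF \<phi>(1)] \<psi>\<phi>)
  qed
  have hom': "\<psi> (br' x y) = br (\<psi> x) (\<psi> y)" for x y
    using \<psi>\<phi>(1)[of "br (\<psi> x) (\<psi> y)"] by (simp add: hom \<psi>\<phi>)
  have "symplectic_form br' (\<lambda>x y. \<omega> (\<psi> x) (\<psi> y))"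
    unfolding symplectic_form_def
  proof (intro conjI allI impI)
    show "two_form (\<lambda>x y. \<omega> (\<psi> x) (\<psi> y))"
      using \<omega> lin by (auto simp: symplectic_form_def two_form_def bilinear_def linear_iff)
    show "ce_differential br' (\<lambda>x y. \<omega> (\<psi> x) (\<psi> y)) x y z = 0" for x y z
      using \<omega> by (simp add: symplectic_form_def ce_differential_def hom')
    fix x assume "\<forall>y. \<omega> (\<psi> x) (\<psi> y) = 0"
    then have "\<forall>y. \<omega> (\<psi> x) y = 0" by (metis \<psi>\<phi>(1))
    then have "\<psi> x = 0" using \<omega> by (simp add: symplectic_form_def)
    then show "x = 0" using \<psi>\<phi>(2)[of x] by (simp add: linear_0[OF \<phi>(1)])
  qed
  then show ?thesis by (auto simp: symplectic_def)
qed

section \<open>From frames of the descending central series to adapted bases\<close>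

text \<open>The shift by 1 puts the second factor of the identity for \<open>2, q, q + 1\<close>
  into weight \<open>2 * q + 2\<close>, where it is a nonzero multiple of \<open>c q (Suc q)\<close>
  by \<open>second_weight\<close>. So the identity says that a square is zero. For
  \<open>q = k\<close> the identity exceeds the bound \<open>N + 1\<close>, and weight
  \<open>2 * k + 1\<close> escapes.\<close>

lemma (in leibniz_array) vanishes_below_shifted:
  assumes N: "N = 2 * k + 1" and start: "c 2 3 = 0"
    and jacobi: "\<And>i j l. 2 \<le> i \<Longrightarrow> 2 \<le> j \<Longrightarrow> 2 \<le> l \<Longrightarrow> i + j + l \<le> N + 1 \<Longrightarrow>
      c i j * c (i + j - 1) l + c j l * c (j + l - 1) i + c l i * c (l + i - 1) j = 0"
    and w: "w \<le> 2 * k"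
  shows "vanishes_at w"
  using w
proof (induction w rule: less_induct)
  case (less w)
  have "w \<le> 4 \<or> w = 5 \<or> (\<exists>m. w = 2 * m + 2 \<and> 1 \<le> m) \<or> (\<exists>q. w = 2 * q + 1 \<and> 3 \<le> q)"
    by presburger
  then consider "w \<le> 4" | "w = 5" | m where "w = 2 * m + 2" "1 \<le> m" | q where "w = 2 * q + 1" "3 \<le> q"
    by blast
  then show ?case
  proof cases
    case 1
    then show ?thesis by (rule vanishes_at_small)
  next
    case 2
    then show ?thesis
      using vanishes_at_Suc[of 4 2 3] less.IH[of 4] less.prems start N by simp
  next
    case (3 m)
    then show ?thesis
      using vanishes_at_even[of m] less.IH[of "2 * m + 1"] less.prems N by simp
  next
    case (4 q)
    have low: "vanishes_at x" if "x \<le> 2 * q" for x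
      using less.IH[of x] less.prems that 4 by simp
    have zero: "c i j = 0" if "2 \<le> i" "2 \<le> j" "i + j \<le> 2 * q" for i j
      by (rule vanishes_atD) (use that low in auto)
    have le: "2 * q + 2 \<le> 2 * k" using 4 less.prems by presburger
    have sum: "q + Suc q - 1 = 2 * q" by simp
    have "c q (Suc q) * c (2 * q) 2 = 0"
      using jacobi[of 2 q "Suc q", unfolded sum] zero[of 2 q] zero[of "Suc q" 2] 4 le N by simp
    moreover have "c (2 * q) 2 = (-1) ^ (2 * q + q) * (real q + 1 - real (2 * q)) * c q (Suc q)"
      by (rule second_weight[OF low]) (use 4 le N in auto)
    ultimately have "c q (Suc q) = 0" using 4 by auto
    then show ?thesis
      using vanishes_at_Suc[OF low, of "2 * q" q "Suc q"] 4 less.prems N by simp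
  qed
qed

text \<open>A basis adapted to the descending central series, in which \<open>e\<^sub>1\<close> and \<open>e\<^sub>2\<close> have the same
  degree; this is why the bracket is only required to have degree \<open>-1\<close> for the numbering.\<close>

locale filiform_frame = basis_family n e for n and e :: "nat \<Rightarrow> 'a::real_vector" +
  fixes br :: "'a \<Rightarrow> 'a \<Rightarrow> 'a" and k :: nat
  assumes n: "n = 2 * k" "2 \<le> k"
    and lie: "lie_algebra br"
    and shift: "2 \<le> i \<Longrightarrow> i < n \<Longrightarrow> br (e 1) (e i) = e (Suc i)"
    and shift_top: "br (e 1) (e n) = 0"
    and filtered: "2 \<le> i \<Longrightarrow> i \<le> n \<Longrightarrow> 2 \<le> j \<Longrightarrow> j \<le> n \<Longrightarrow> br (e i) (e j) \<in> filtration n e (i + j - 1)"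
begin

lemma n_ge: "4 \<le> n" using n by simp

lemma bilinear_br: "bilinear br" and br_self: "br x x = 0"
  and br_jacobi: "br x (br y z) + br y (br z x) + br z (br x y) = 0"
  using lie by (auto simp: lie_algebra_def)

lemma br_skew: "br y x = - br x y"
  by (rule alternating_skew[OF bilinear_br br_self])

lemma br_jacobi': "br (br x y) z + br (br y z) x + br (br z x) y = 0"
proof -
  have *: "br (br x y) z + br (br y z) x + br (br z x) y = - (br x (br y z) + br y (br z x) + br z (br x y))"
    by (simp add: br_skew[of z "br x y"] br_skew[of x "br y z"] br_skew[of y "br z x"])
  show ?thesis unfolding * br_jacobi by simp
qed

lemma shift_derivation: "br (e 1) (br x y) = br (br (e 1) x) y + br x (br (e 1) y)"
proof -
  have "br (br (e 1) x) y = - br y (br (e 1) x)" "br x (br (e 1) y) = - br x (br y (e 1))"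
    using br_skew[of y "br (e 1) x"] br_skew[of "e 1" y] by (simp_all add: bilinear_rneg[OF bilinear_br])
  then show ?thesis
    using br_jacobi[of "e 1" x y] by (simp add: algebra_simps add_eq_0_iff)
qed

lemma bilinear_co_br: "bilinear (\<lambda>x y. co w (br x y))"
  using bilinear_br linear_co[of w] by (auto simp: bilinear_def linear_iff)

lemma filtered_zero:
  "2 \<le> i \<Longrightarrow> i \<le> n \<Longrightarrow> 2 \<le> j \<Longrightarrow> j \<le> n \<Longrightarrow> n + 2 \<le> i + j \<Longrightarrow> br (e i) (e j) = 0"
  using filtered[of i j] filtration_top[of "i + j - 1"] by auto

text \<open>The structure constants of the graded algebra of the central series, in which
  \<open>[e_i, e_j]\<close> starts at \<open>e_(i+j-1)\<close>. In an adapted basis all of them are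
  zero.\<close>

definition d :: "nat \<Rightarrow> nat \<Rightarrow> real" where
  "d i j = (if 2 \<le> i \<and> 2 \<le> j \<and> i + j \<le> n + 1 then co (i + j - 1) (br (e i) (e j)) else 0)"

lemma leading_shift:
  assumes "2 \<le> p" "p < n" "x \<in> filtration n e p"
  shows "co (Suc p) (br (e 1) x) = co p x"
proof -
  have lin: "linear (br (e 1))" using bilinear_br by (simp add: bilinear_def)
  have "br (e 1) (\<Sum>i=1..n. co i x *\<^sub>R e i) = (\<Sum>i=1..n. co i x *\<^sub>R br (e 1) (e i))"
    by (simp only: linear_sum[OF lin] linear_scale[OF lin])
  then have "co (Suc p) (br (e 1) x) = (\<Sum>i=1..n. co i x * co (Suc p) (br (e 1) (e i)))"
    unfolding expansion by (simp add: co_sum co_scaleR)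
  also have "\<dots> = (\<Sum>i=1..n. if i = p then co p x else 0)"
  proof (intro sum.cong refl)
    fix i assume i: "i \<in> {1..n}"
    show "co i x * co (Suc p) (br (e 1) (e i)) = (if i = p then co p x else 0)"
    proof (cases "i < p")
      case True
      then show ?thesis using assms i by (auto simp: filtration_iff)
    next
      case False
      then show ?thesis
        using assms i shift[of i] by (cases "i = n") (auto simp: co_basis shift_top[simplified] co_zero)
    qed
  qed
  also have "\<dots> = co p x" using assms by simp
  finally show ?thesis .
qed

lemma leibniz_array_d: "leibniz_array d (n + 1)"
proof
  show "d j i = - d i j" for i j
    using br_skew[of "e i" "e j"] by (simp add: d_def add.commute co_minus)
  fix i j :: nat
  assume ij: "2 \<le> i" "2 \<le> j" "i + j < n + 1"
  have "co (Suc (i + j - 1)) (br (e 1) (br (e i) (e j))) = co (i + j - 1) (br (e i) (e j))"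
    by (rule leading_shift) (use ij filtered in auto)
  then show "d (Suc i) j + d i (Suc j) = d i j"
    using ij by (simp add: d_def shift_derivation[simplified] shift[simplified] co_add)
qed

lemma d_jacobi:
  assumes "2 \<le> i" "2 \<le> j" "2 \<le> l" "i + j + l \<le> n + 2"
  shows "d i j * d (i + j - 1) l + d j l * d (j + l - 1) i + d l i * d (l + i - 1) j = 0"
proof -
  define w where "w = i + j + l - 2"
  have lead: "co w (br (br (e a) (e b)) (e m)) = d a b * d (a + b - 1) m"
    if abm: "2 \<le> a" "2 \<le> b" "2 \<le> m" "a + b + m = w + 2" for a b m
  proof -
    have "co w (br (br (e a) (e b)) (e m)) =
        co (a + b - 1) (br (e a) (e b)) * co m (e m) * co w (br (e (a + b - 1)) (e m))"
    proof (rule bilinear_leading[OF bilinear_co_br])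
      show "br (e a) (e b) \<in> filtration n e (a + b - 1)"
        by (rule filtered) (use abm assms w_def in auto)
      show "e m \<in> filtration n e m"
        by (rule basis_in_filtration) (use abm assms w_def in auto)
      show "co w (br (e i') (e j')) = 0"
        if *: "a + b - 1 \<le> i'" "i' \<le> n" "m \<le> j'" "j' \<le> n" "a + b - 1 + m < i' + j'" for i' j'
      proof -
        have "br (e i') (e j') \<in> filtration n e (i' + j' - 1)"
          by (rule filtered) (use * abm in auto)
        moreover have "w \<in> {1..n}" "w < i' + j' - 1"
          using * abm assms w_def by auto
        ultimately show ?thesis
          using filtration_iff[of "i' + j' - 1"] by auto
      qed
    qed (use abm assms w_def in auto)
    also have "\<dots> = d a b * d (a + b - 1) m"
    proof -
      have "a + b - 1 + m - 1 = w" "a + b - 1 + m \<le> n + 1" "2 \<le> a + b - 1" "a + b \<le> n + 1" "m \<in> {1..n}"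
        using abm assms w_def by auto
      then show ?thesis using abm by (simp add: d_def co_basis)
    qed
    finally show ?thesis .
  qed
  have "co w (br (br (e i) (e j)) (e l) + br (br (e j) (e l)) (e i) + br (br (e l) (e i)) (e j)) = 0"
    unfolding br_jacobi' by (rule co_zero)
  then show ?thesis
    using lead[of i j l] lead[of j l i] lead[of l i j] assms by (simp add: co_add w_def)
qed

lemma d_zero:
  assumes "d 2 3 = 0" "2 \<le> i" "2 \<le> j" "i + j \<le> n"
  shows "d i j = 0"
proof -
  interpret d: leibniz_array d "n + 1" by (rule leibniz_array_d)
  have "d.vanishes_at (i + j)"
    by (rule d.vanishes_below_shifted[where k = k]) (use n assms d_jacobi in auto)
  then show ?thesis using assms by (intro d.vanishes_atD)
qed

text \<open>All lower weights vanish, so the constants of weight \<open>n + 1\<close> alternate; the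
  brackets lie on the line of \<open>e n\<close> and have no further terms.\<close>

lemma d_top:
  assumes "d 2 3 = 0" "2 \<le> i" "2 \<le> j" "i + j = n + 1"
  shows "br (e i) (e j) = ((-1) ^ i * d 2 (n - 1)) *\<^sub>R e n"
proof -
  interpret d: leibniz_array d "n + 1" by (rule leibniz_array_d)
  have "d.vanishes_at n"
    unfolding d.vanishes_at_def using d_zero assms(1) by auto
  then have "d i j = (-1) ^ (i + 2) * d 2 (n - 1)"
    by (rule d.alternating) (use assms n_ge in auto)
  then have co: "co n (br (e i) (e j)) = (-1) ^ i * d 2 (n - 1)"
    using assms by (simp add: d_def)
  have "br (e i) (e j) \<in> filtration n e n"
    using filtered[of i j] assms by simp
  then show ?thesis
    using n_ge co by (intro co_eqI) (auto simp: filtration_iff co_scaleR co_basis)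
qed

lemma filtered_improved:
  assumes "d 2 3 = 0" "2 \<le> i" "2 \<le> j" "i + j \<le> n"
  shows "br (e i) (e j) \<in> filtration n e (i + j)"
proof -
  have "co (i + j - 1) (br (e i) (e j)) = 0"
    using d_zero[OF assms] assms by (simp add: d_def)
  moreover have "br (e i) (e j) \<in> filtration n e (i + j - 1)"
    by (rule filtered) (use assms in auto)
  ultimately have "co l (br (e i) (e j)) = 0" if "l \<in> {1..n}" "l < i + j" for l
    using that assms by (cases "l = i + j - 1") (auto simp: filtration_iff)
  then show ?thesis using assms by (simp add: filtration_iff)
qed

section \<open>A symplectic form on a frame of the central series\<close>

context
  fixes \<omega> :: "'a \<Rightarrow> 'a \<Rightarrow> real"
  assumes \<omega>: "symplectic_form br \<omega>"
begin

lemma bilinear_form: "bilinear \<omega>" and form_self: "\<omega> x x = 0"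
  and nondegenerate: "(\<And>y. \<omega> x y = 0) \<Longrightarrow> x = 0"
  using \<omega> by (auto simp: symplectic_form_def two_form_def)

lemma form_skew: "\<omega> y x = - \<omega> x y"
  by (rule alternating_skew[OF bilinear_form form_self])

lemma form_cyclic: "\<omega> (br x y) z + \<omega> (br y z) x + \<omega> (br z x) y = 0"
proof -
  have "ce_differential br \<omega> x y z = 0" using \<omega> by (simp add: symplectic_form_def)
  then show ?thesis
    using br_skew[of z x] by (simp add: ce_differential_def bilinear_lneg[OF bilinear_form])
qed

lemma form_shift: "\<omega> (br (e 1) x) y + \<omega> x (br (e 1) y) = - \<omega> (br x y) (e 1)"
  using form_cyclic[of "e 1" x y] form_skew[of "br (e 1) y" x] br_skew[of y "e 1"]
  by (simp add: bilinear_lneg[OF bilinear_form])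

text \<open>\<open>e j\<close> is the bracket of \<open>e 1\<close> and \<open>e (j - 1)\<close>,
  and \<open>e n\<close> is central.\<close>

lemma form_center:
  assumes "3 \<le> j" "j \<le> n"
  shows "\<omega> (e n) (e j) = 0"
proof -
  have "br (e (j - 1)) (e n) = 0" "br (e 1) (e (j - 1)) = e j"
    using filtered_zero[of "j - 1" n] shift[of "j - 1"] assms by auto
  then have "\<omega> (e j) (e n) = 0"
    using form_shift[of "e (j - 1)" "e n"] shift_top
    by (simp add: bilinear_lzero[OF bilinear_form] bilinear_rzero[OF bilinear_form])
  then show ?thesis using form_skew[of "e j" "e n"] by simp
qed

text \<open>Closedness against \<open>e 1\<close> makes the values alternate along the antidiagonal,
  and its end at \<open>i = n\<close> is covered by \<open>form_center\<close>.\<close>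

lemma form_far:
  assumes "i \<le> n" "j \<le> n" "n + 3 \<le> i + j"
  shows "\<omega> (e i) (e j) = 0"
proof -
  define w where "w = i + j"
  define g where "g i = (-1) ^ i * \<omega> (e i) (e (w - i))" for i
  have const: "g i = g (w - n)" if "w - n \<le> i" "i \<le> n" for i
  proof (rule constant_from[where g = g, OF _ that])
    fix i assume i: "w - n \<le> i" "i < n"
    have "br (e 1) (e i) = e (Suc i)" "br (e 1) (e (w - Suc i)) = e (w - i)" "br (e i) (e (w - Suc i)) = 0"
      using shift[of i] shift[of "w - Suc i"] filtered_zero[of i "w - Suc i"] i assms
      by (auto simp: w_def Suc_diff_Suc)
    then have "\<omega> (e (Suc i)) (e (w - Suc i)) = - \<omega> (e i) (e (w - i))"
      using form_shift[of "e i" "e (w - Suc i)"] by (simp add: bilinear_lzero[OF bilinear_form])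
    then show "g (Suc i) = g i" by (simp add: g_def)
  qed
  have "g i = g n" using const[of i] const[of n] assms by (simp add: w_def)
  also have "g n = 0" using form_center[of "w - n"] assms by (simp add: g_def w_def)
  finally show ?thesis by (simp add: g_def w_def)
qed

text \<open>Here the brackets from \<open>d_top\<close> add the constant \<open>a\<close> at each
  step along the antidiagonal. The values are linear up to sign, with zero at the diagonal place
  \<open>i = k + 1\<close>.\<close>

lemma form_near:
  assumes "d 2 3 = 0" "2 \<le> i" "2 \<le> j" "i + j = n + 2"
  shows "\<omega> (e i) (e j) = (-1) ^ i * ((real i - (real k + 1)) * d 2 (n - 1) * \<omega> (e n) (e 1))"
proof -
  define a where "a = d 2 (n - 1) * \<omega> (e n) (e 1)"
  define g where "g i = (-1) ^ i * \<omega> (e i) (e (n + 2 - i)) - real i * a" for i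
  have const: "g i = g 2" if "2 \<le> i" "i \<le> n" for i
  proof (rule constant_from[where g = g, OF _ that])
    fix i assume i: "2 \<le> i" "i < n"
    have "br (e 1) (e i) = e (Suc i)" "br (e 1) (e (n + 1 - i)) = e (n + 2 - i)"
      "br (e i) (e (n + 1 - i)) = ((-1) ^ i * d 2 (n - 1)) *\<^sub>R e n"
      using shift[of i] shift[of "n + 1 - i"] d_top[OF assms(1), of i "n + 1 - i"] i
      by (auto simp: Suc_diff_le)
    then have "(-1) ^ i * (\<omega> (e (Suc i)) (e (n + 1 - i)) + \<omega> (e i) (e (n + 2 - i))) = - a"
      using form_shift[of "e i" "e (n + 1 - i)"]
      by (simp add: bilinear_lmul[OF bilinear_form] a_def mult.assoc[symmetric] flip: power_mult_distrib)
    moreover have "n + 2 - Suc i = n + 1 - i" using i by simp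
    ultimately show "g (Suc i) = g i"
      by (simp add: g_def algebra_simps)
  qed
  have "g i = g (k + 1)" using const[of i] const[of "k + 1"] assms n by simp
  moreover have "g (k + 1) = - (real k + 1) * a"
    using form_self[of "e (k + 1)"] n by (simp add: g_def algebra_simps)
  moreover have "n + 2 - i = j" using assms by simp
  ultimately have "(-1) ^ i * \<omega> (e i) (e j) = (real i - (real k + 1)) * a"
    by (simp add: g_def algebra_simps)
  then have "(-1) ^ i * ((-1) ^ i * \<omega> (e i) (e j)) = (-1) ^ i * ((real i - (real k + 1)) * a)"
    by simp
  then show ?thesis
    by (simp add: a_def mult.assoc[symmetric] flip: power_mult_distrib)
qed

text \<open>Closedness on \<open>e 2\<close>, \<open>e 3\<close>, \<open>e (n - 2)\<close> isolates
  \<open>\<omega> (e n) (e 2)\<close>, because the other two terms have weight at least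
  \<open>n + 3\<close>. With a nonzero coefficient this value is zero, then \<open>form_near\<close>
  gives the same for \<open>e 1\<close>, and \<open>e n\<close> lies in the kernel of the
  form.\<close>

lemma d_top_zero:
  assumes d23: "d 2 3 = 0"
  shows "d 2 (n - 1) = 0"
proof (cases "k = 2")
  case True
  \<comment> \<open>In dimension 4 the coefficient in question is \<open>d 2 3\<close>
    itself.\<close>
  then show ?thesis using d23 n by simp
next
  case False
  then have n6: "6 \<le> n" using n by simp
  show ?thesis
  proof (rule ccontr)
    assume \<delta>: "d 2 (n - 1) \<noteq> 0"
    have sub0: "subspace {0 :: real}" by (rule subspace_single_0)
    have "\<omega> (br (e 2) (e 3)) (e (n - 2)) \<in> {0}"
      by (rule bilinear_filtered[OF bilinear_form sub0 filtered_improved[OF d23] basis_in_filtration[of "n - 2"]])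
        (use n6 form_far in auto)
    moreover have "\<omega> (br (e (n - 2)) (e 2)) (e 3) \<in> {0}"
      by (rule bilinear_filtered[OF bilinear_form sub0 filtered_improved[OF d23] basis_in_filtration[of 3]])
        (use n6 form_far in auto)
    moreover have "br (e 3) (e (n - 2)) = (- d 2 (n - 1)) *\<^sub>R e n"
      using d_top[OF d23, of 3 "n - 2"] n6 by simp
    ultimately have "d 2 (n - 1) * \<omega> (e n) (e 2) = 0"
      using form_cyclic[of "e 2" "e 3" "e (n - 2)"] by (simp add: bilinear_lmul[OF bilinear_form] bilinear_lneg[OF bilinear_form])
    then have e2: "\<omega> (e n) (e 2) = 0" using \<delta> by simp
    then have "(real n - (real k + 1)) * d 2 (n - 1) * \<omega> (e n) (e 1) = 0"
      using form_near[OF d23, of n 2] n6 by simp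
    moreover have "real n - (real k + 1) \<noteq> 0" using n6 n by simp
    ultimately have e1: "\<omega> (e n) (e 1) = 0" using \<delta> by simp
    have zero: "\<omega> (e n) (e i) = 0" if "i \<in> {1..n}" for i
    proof -
      have "i = 1 \<or> i = 2 \<or> 3 \<le> i" using that by auto
      then show ?thesis using e1 e2 form_center that by auto
    qed
    have lin: "linear (\<omega> (e n))" "linear (\<lambda>x. 0 :: real)"
      using bilinear_form by (auto simp: bilinear_def linear_iff)
    have "\<omega> (e n) y = 0" for y
      by (rule linear_eq_basis[OF lin zero])
    then have "e n = 0" by (rule nondegenerate)
    then show False using co_basis[of n n] n6 by (simp add: co_zero)
  qed
qed

lemma adapted_basis:
  assumes d23: "d 2 3 = 0"
  shows "adapted_basis n br e"
proof -
  have zero_in: "0 \<in> filtration n e p" for p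
    by (rule subspace_0[OF filtration_subspace])
  have main: "br (e i) (e j) \<in> filtration n e (i + j)" if ij: "2 \<le> i" "i \<le> n" "2 \<le> j" "j \<le> n" for i j
  proof -
    consider "i + j \<le> n" | "i + j = n + 1" | "n + 2 \<le> i + j" by linarith
    then show ?thesis
    proof cases
      case 1
      then show ?thesis using filtered_improved d23 ij by simp
    next
      case 2
      then have "br (e i) (e j) = 0" using d_top[OF d23, of i j] d_top_zero[OF d23] ij by simp
      then show ?thesis by (simp add: zero_in)
    next
      case 3
      then have "br (e i) (e j) = 0" using filtered_zero ij by simp
      then show ?thesis by (simp add: zero_in)
    qed
  qed
  have one: "br (e 1) (e j) \<in> filtration n e (1 + j)" if "1 \<le> j" "j \<le> n" for j
  proof -
    have "j = 1 \<or> j = n \<or> 2 \<le> j \<and> j < n" using that by auto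
    then consider "j = 1" | "j = n" | "2 \<le> j" "j < n" by blast
    then show ?thesis
    proof cases
      case 1
      then show ?thesis by (simp add: br_self zero_in)
    next
      case 2
      then have "br (e 1) (e j) = 0" by (simp only: shift_top)
      then show ?thesis by (simp add: zero_in)
    next
      case 3
      then have "br (e 1) (e j) = e (Suc j)" by (rule shift)
      then show ?thesis using basis_in_filtration[of "1 + j" "Suc j"] 3 by simp
    qed
  qed
  have "br (e i) (e j) \<in> filtration n e (i + j)" if ij: "i \<in> {1..n}" "j \<in> {1..n}" for i j
  proof -
    have "i = 1 \<or> j = 1 \<or> 2 \<le> i \<and> 2 \<le> j" using ij by auto
    then consider "i = 1" | "j = 1" | "2 \<le> i" "2 \<le> j" by blast
    then show ?thesis
    proof cases
      case 1
      then show ?thesis using one[of j] ij by simp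
    next
      case 2
      have "- br (e 1) (e i) \<in> filtration n e (1 + i)"
        using ij by (intro subspace_neg[OF filtration_subspace] one) auto
      then show ?thesis
        unfolding 2 br_skew[of "e i" "e 1"] by (simp only: add.commute)
    next
      case 3
      then show ?thesis using main[of i j] ij by simp
    qed
  qed
  moreover have "br (e 1) (e i) = e (i + 1)" if "i \<in> {2..n - 1}" for i
  proof -
    have "2 \<le> i" "i < n" using that n_ge by auto
    then show ?thesis using shift by simp
  qed
  ultimately show ?thesis
    unfolding adapted_basis_def using basis by blast
qed

end

end

section \<open>Existence of a frame\<close>

declare central_seq.simps [simp del]

locale filiform_algebra =
  fixes n :: nat and br :: "'a::real_vector \<Rightarrow> 'a \<Rightarrow> 'a"
  assumes filiform: "filiform n br" and n_ge: "4 \<le> n"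
begin

abbreviation C :: "nat \<Rightarrow> 'a set" where "C \<equiv> central_seq br"

lemma bilinear_br: "bilinear br" and br_self: "br x x = 0"
  and br_jacobi: "br x (br y z) + br y (br z x) + br z (br x y) = 0"
  and dim_UNIV: "dim (UNIV :: 'a set) = n"
  and C_last: "C (n - 1) \<noteq> {0}" and C_top: "C n = {0}"
  using filiform by (auto simp: filiform_def lie_algebra_def)

lemmas br_add = bilinear_ladd[OF bilinear_br] bilinear_radd[OF bilinear_br]
  and br_scaleR = bilinear_lmul[OF bilinear_br] bilinear_rmul[OF bilinear_br]
  and br_diff = bilinear_lsub[OF bilinear_br] bilinear_rsub[OF bilinear_br]

lemma br_skew: "br y x = - br x y"
  by (rule alternating_skew[OF bilinear_br br_self])

lemma C_one: "C 1 = UNIV"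
  by (simp add: central_seq.simps)

lemma C_Suc: "1 \<le> i \<Longrightarrow> C (Suc i) = span {br x y | x y. y \<in> C i}"
  by (cases i) (auto simp: central_seq.simps)

lemma subspace_C: "1 \<le> i \<Longrightarrow> subspace (C i)"
  using C_Suc[of "i - 1"] C_one by (cases "i = 1") auto

lemma br_C: "1 \<le> i \<Longrightarrow> y \<in> C i \<Longrightarrow> br x y \<in> C (Suc i)"
  unfolding C_Suc by (rule span_base) auto

lemma br_C': "1 \<le> i \<Longrightarrow> x \<in> C i \<Longrightarrow> br x y \<in> C (Suc i)"
  using br_C[of i x y] br_skew[of x y] subspace_neg[OF subspace_C[of "Suc i"]] by force

lemma C_Suc_subset: "1 \<le> i \<Longrightarrow> C (Suc i) \<subseteq> C i"
proof (induction i rule: nat_induct_at_least)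
  case (Suc i)
  have "C (Suc (Suc i)) = span {br x y | x y. y \<in> C (Suc i)}" by (rule C_Suc) simp
  also have "\<dots> \<subseteq> span {br x y | x y. y \<in> C i}" using Suc.IH by (intro span_mono) blast
  also have "\<dots> = C (Suc i)" using C_Suc[OF Suc.hyps] by simp
  finally show ?case .
qed (simp add: C_one[simplified])

lemma C_antimono:
  assumes "1 \<le> i" "i \<le> j"
  shows "C j \<subseteq> C i"
  using assms(2)
proof (induction j rule: dec_induct)
  case (step j)
  then show ?case using C_Suc_subset[of j] assms by auto
qed simp

lemma br_C_C:
  assumes "1 \<le> a" "1 \<le> b" "x \<in> C a" "y \<in> C b"
  shows "br x y \<in> C (a + b)"
  using assms
proof (induction a arbitrary: b x y rule: nat_induct_at_least)
  case base
  then show ?case using br_C[of b y x] by simp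
next
  case (Suc a)
  have "subspace {x. br x y \<in> C (Suc a + b)}"
    using subspace_C[of "Suc a + b"]
    by (auto simp: subspace_def br_add br_scaleR bilinear_lzero[OF bilinear_br])
  moreover have "br (br u v) y \<in> C (Suc a + b)" if v: "v \<in> C a" for u v
  proof -
    have "br u (br v y) \<in> C (Suc (a + b))"
      using Suc.IH[OF Suc.prems(1) v Suc.prems(3)] Suc.prems by (intro br_C) auto
    moreover have "br v (br y u) \<in> C (a + Suc b)"
      using br_C'[OF Suc.prems(1,3), of u] v Suc.prems by (intro Suc.IH) auto
    moreover have "br (br u v) y = br u (br v y) + br v (br y u)"
      using br_jacobi[of u v y] br_skew[of y "br u v"] by (simp add: add_eq_0_iff)
    ultimately show ?thesis
      using subspace_add[OF subspace_C[of "Suc (a + b)"]] by simp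
  qed
  ultimately have "span {br u v | u v. v \<in> C a} \<subseteq> {x. br x y \<in> C (Suc a + b)}"
    by (intro span_minimal) auto
  then show ?case using Suc.prems C_Suc[OF Suc.hyps] by auto
qed

lemma C_strict:
  assumes "1 \<le> i" "i < n"
  shows "\<not> C i \<subseteq> C (Suc i)"
proof
  assume sub: "C i \<subseteq> C (Suc i)"
  have "C i \<subseteq> C j" if "i \<le> j" for j
    using that
  proof (induction j rule: dec_induct)
    case (step j)
    have "C (Suc i) \<subseteq> C (Suc j)"
      unfolding C_Suc[OF assms(1)] C_Suc[OF order.trans[OF assms(1) step(1)]]
      using step by (intro span_mono) blast
    then show ?case using sub by auto
  qed simp
  then have "C i \<subseteq> {0}" using C_top assms by (metis less_imp_le)
  moreover have "C (n - 1) \<subseteq> C i" by (rule C_antimono) (use assms in auto)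
  moreover have "0 \<in> C (n - 1)" by (intro subspace_0 subspace_C) (use n_ge in simp)
  ultimately show False using C_last by blast
qed

text \<open>A lower bound for the dimension of \<open>S\<close>. It grows by one along each strict
  inclusion, so the dimensions of the terms of the central series need not be computed
  separately.\<close>

definition has_independent :: "'a set \<Rightarrow> nat \<Rightarrow> bool" where
  "has_independent S m \<longleftrightarrow> (\<exists>B\<subseteq>S. finite B \<and> independent B \<and> card B = m)"

lemma has_independent_insert:
  assumes "has_independent S m" "S \<subseteq> T" "subspace S" "x \<in> T" "x \<notin> S"
  shows "has_independent T (Suc m)"
proof -
  obtain B where B: "B \<subseteq> S" "finite B" "independent B" "card B = m"
    using assms(1) by (auto simp: has_independent_def)
  have "x \<notin> span B" using span_minimal[OF B(1) assms(3)] assms(5) by auto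
  moreover from this have "x \<notin> B" using span_base by blast
  ultimately have "independent (insert x B)" "card (insert x B) = Suc m"
    using B by (simp_all add: independent_insert)
  then show ?thesis
    using B assms unfolding has_independent_def by (intro exI[of _ "insert x B"]) auto
qed

lemma has_independent_C:
  assumes "1 \<le> j" "j \<le> i" "i \<le> n" "has_independent (C i) m"
  shows "has_independent (C j) (m + (i - j))"
  using assms(2,1)
proof (induction j rule: inc_induct)
  case base
  then show ?case using assms by simp
next
  case (step j)
  then obtain x where "x \<in> C j" "x \<notin> C (Suc j)"
    using C_strict[of j] assms by auto
  then have "has_independent (C j) (Suc (m + (i - Suc j)))"
    using step C_Suc_subset[of j] subspace_C[of "Suc j"] has_independent_insert[of "C (Suc j)"] by simp
  then show ?case using step by (simp add: Suc_diff_Suc)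
qed

lemma has_independent_C_codim: "1 \<le> i \<Longrightarrow> i \<le> n \<Longrightarrow> has_independent (C i) (n - i)"
proof -
  assume "1 \<le> i" "i \<le> n"
  moreover have "has_independent (C n) 0"
    unfolding has_independent_def by (intro exI[of _ "{}"]) (simp add: independent_empty)
  ultimately show ?thesis using has_independent_C[of i n 0] by simp
qed

lemma not_has_independent: "\<not> has_independent (UNIV :: 'a set) (Suc n)"
proof
  assume "has_independent (UNIV :: 'a set) (Suc n)"
  then obtain A :: "'a set" where A: "independent A" "card A = Suc n"
    by (auto simp: has_independent_def)
  obtain B :: "'a set" where B: "UNIV \<subseteq> span B" "card B = n"
    using basis_exists[of UNIV] dim_UNIV by metis
  then have "finite B" using n_ge card.infinite by fastforce
  then show False
    using independent_span_bound[of B A] A B by auto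
qed

text \<open>If \<open>x\<close> and \<open>C 2\<close> spanned the algebra,
  \<open>[x, x] = 0\<close> would put every bracket into \<open>C 3\<close>.\<close>

lemma C_two_codim: "\<exists>y. y \<notin> span (insert x (C 2))"
proof (rule ccontr)
  assume "\<nexists>y. y \<notin> span (insert x (C 2))"
  then have "\<exists>a. y - a *\<^sub>R x \<in> span (C 2)" for y
    using span_breakdown_eq[of y x "C 2"] by blast
  then have all: "\<exists>a. y - a *\<^sub>R x \<in> C 2" for y
    using subspace_C[of 2] by (simp add: span_eq_iff[symmetric] del: span_eq_iff)
  have "br z w \<in> C 3" for z w
  proof -
    obtain a b where ab: "z - a *\<^sub>R x \<in> C 2" "w - b *\<^sub>R x \<in> C 2" using all by meson
    have "br (z - a *\<^sub>R x) w \<in> C 3" "br x (w - b *\<^sub>R x) \<in> C 3"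
      using br_C'[OF _ ab(1)] br_C[OF _ ab(2)] by simp_all
    then have "br (z - a *\<^sub>R x) w + a *\<^sub>R br x (w - b *\<^sub>R x) \<in> C 3"
      using subspace_C[of 3] by (intro subspace_add subspace_scale) auto
    then show ?thesis by (simp add: br_diff br_scaleR br_self)
  qed
  then have "C 2 \<subseteq> C 3"
    using C_Suc[of 1] span_minimal[OF _ subspace_C[of 3], of "{br x y | x y. y \<in> C 1}"]
    by (auto simp: numeral_2_eq_2)
  then show False using C_strict[of 2] n_ge by simp
qed

text \<open>The count is tight: two dimensions above \<open>C 2\<close> and at least one for each of
  the \<open>n - 2\<close> strict steps from \<open>C 2\<close> to \<open>C n\<close> already use up
  \<open>n\<close>, so no step is larger.\<close>

lemma C_one_step:
  assumes "2 \<le> i" "i < n" "u \<in> C i" "u \<notin> C (Suc i)" "y \<in> C i"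
  shows "\<exists>a. y - a *\<^sub>R u \<in> C (Suc i)"
proof (rule ccontr)
  assume no: "\<nexists>a. y - a *\<^sub>R u \<in> C (Suc i)"
  have span_C: "span (C (Suc i)) = C (Suc i)" using subspace_C[of "Suc i"] assms by simp
  define S where "S = span (insert u (C (Suc i)))"
  have "y \<notin> S"
    using no span_breakdown_eq[of y u "C (Suc i)"] span_C by (simp add: S_def)
  have "has_independent S (Suc (n - Suc i))"
    using has_independent_insert[of "C (Suc i)" "n - Suc i" S u] has_independent_C_codim[of "Suc i"]
      subspace_C[of "Suc i"] assms span_superset[of "insert u (C (Suc i))"] by (auto simp: S_def)
  moreover have "S \<subseteq> C i"
    unfolding S_def using assms C_Suc_subset[of i] subspace_C[of i] by (intro span_minimal) auto
  ultimately have "has_independent (C i) (Suc (Suc (n - Suc i)))"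
    by (rule has_independent_insert) (use \<open>y \<notin> S\<close> assms in \<open>auto simp: S_def\<close>)
  then have "has_independent (C 2) (Suc (Suc (n - Suc i)) + (i - 2))"
    using assms by (intro has_independent_C) auto
  moreover have "Suc (Suc (n - Suc i)) + (i - 2) = n - 1" using assms by simp
  ultimately have "has_independent (C 2) (n - 1)" by (simp only:)
  moreover obtain x where x: "x \<notin> C 2"
    using C_strict[of 1] n_ge by (auto simp: numeral_2_eq_2)
  ultimately have "has_independent (span (insert x (C 2))) (Suc (n - 1))"
    using has_independent_insert[of "C 2" "n - 1" "span (insert x (C 2))" x] subspace_C[of 2]
      span_superset[of "insert x (C 2)"] by auto
  then have "has_independent UNIV (Suc (Suc (n - 1)))"
    using C_two_codim[of x] has_independent_insert[of "span (insert x (C 2))" "Suc (n - 1)" UNIV] by auto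
  then show False using not_has_independent n_ge by simp
qed

lemma C_first_step:
  assumes "x \<notin> C 2" "y \<notin> span (insert x (C 2))"
  shows "\<exists>a b. z - a *\<^sub>R x - b *\<^sub>R y \<in> C 2"
proof (rule ccontr)
  assume no: "\<nexists>a b. z - a *\<^sub>R x - b *\<^sub>R y \<in> C 2"
  have span_C: "span (C 2) = C 2" using subspace_C[of 2] by simp
  have z: "z \<notin> span (insert y (insert x (C 2)))"
  proof
    assume "z \<in> span (insert y (insert x (C 2)))"
    then obtain b where "z - b *\<^sub>R y \<in> span (insert x (C 2))"
      using span_breakdown_eq by blast
    then obtain a where "z - b *\<^sub>R y - a *\<^sub>R x \<in> C 2"
      using span_breakdown_eq[of _ x] span_C by blast
    moreover have "z - b *\<^sub>R y - a *\<^sub>R x = z - a *\<^sub>R x - b *\<^sub>R y" by simp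
    ultimately show False using no by auto
  qed
  have "has_independent (span (insert x (C 2))) (Suc (n - 2))"
    using has_independent_insert[of "C 2" "n - 2" "span (insert x (C 2))" x] subspace_C[of 2]
      span_superset[of "insert x (C 2)"] has_independent_C_codim[of 2] n_ge assms by auto
  then have "has_independent (span (insert y (insert x (C 2)))) (Suc (Suc (n - 2)))"
    by (rule has_independent_insert) (use assms in \<open>auto intro: span_base span_mono[THEN subsetD]\<close>)
  then have "has_independent UNIV (Suc (Suc (Suc (n - 2))))"
    by (rule has_independent_insert) (use z in auto)
  then show False using not_has_independent n_ge by (simp add: Suc_diff_Suc numeral_2_eq_2)
qed

text \<open>For \<open>2 \<le> i \<le> n - 2\<close> the elements whose bracket sends \<open>C\<^sup>i\<close> into \<open>C\<^sup>i\<^sup>+\<^sup>2\<close> form a proper subspace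
  containing \<open>C\<^sup>2\<close>, so a line transversal to \<open>C\<^sup>2\<close> meets these subspaces in finitely many points.\<close>

lemma exists_generic:
  obtains x where "x \<notin> C 2"
    and "\<And>i u. 2 \<le> i \<Longrightarrow> i \<le> n - 2 \<Longrightarrow> u \<in> C i \<Longrightarrow> u \<notin> C (Suc i) \<Longrightarrow> br x u \<notin> C (Suc (Suc i))"
proof -
  define K where "K i = {x. \<forall>y\<in>C i. br x y \<in> C (Suc (Suc i))}" for i
  have subK: "subspace (K i)" for i
    using subspace_C[of "Suc (Suc i)"]
    by (auto simp: subspace_def K_def br_add br_scaleR bilinear_lzero[OF bilinear_br])
  have C2K: "C 2 \<subseteq> K i" if "1 \<le> i" for i
    using br_C_C[of 2 i] that by (auto simp: K_def)
  obtain a where a: "a \<notin> C 2"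
    using C_strict[of 1] n_ge by (auto simp: numeral_2_eq_2)
  obtain b where b: "b \<notin> span (insert a (C 2))" using C_two_codim by blast
  have proper: "K i \<noteq> UNIV" if "2 \<le> i" "i \<le> n - 2" for i
  proof
    assume "K i = UNIV"
    then have "{br x y | x y. y \<in> C i} \<subseteq> C (Suc (Suc i))" by (auto simp: K_def)
    then have "C (Suc i) \<subseteq> C (Suc (Suc i))"
      using C_Suc[of i] span_minimal subspace_C[of "Suc (Suc i)"] that by simp
    then show False using C_strict[of "Suc i"] that n_ge by simp
  qed
  have unique: "s = t" if i: "2 \<le> i" "i \<le> n - 2" and st: "a + s *\<^sub>R b \<in> K i" "a + t *\<^sub>R b \<in> K i" for i s t
  proof (rule ccontr)
    assume "s \<noteq> t"
    \<comment> \<open>Two points of the line yield \<open>b\<close> and then \<open>a\<close>;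
      together with \<open>C 2\<close> these span everything, but \<open>K i\<close> is
      proper.\<close>
    have "(1 / (s - t)) *\<^sub>R ((a + s *\<^sub>R b) - (a + t *\<^sub>R b)) \<in> K i"
      by (intro subspace_scale subspace_diff subK st)
    also have "(1 / (s - t)) *\<^sub>R ((a + s *\<^sub>R b) - (a + t *\<^sub>R b)) = b"
      using \<open>s \<noteq> t\<close> by (simp flip: scaleR_left_diff_distrib)
    finally have bK: "b \<in> K i" .
    have "(a + s *\<^sub>R b) - s *\<^sub>R b \<in> K i"
      by (intro subspace_scale subspace_diff subK st bK)
    then have aK: "a \<in> K i" by simp
    have "z \<in> K i" for z
    proof -
      obtain p q where "z - p *\<^sub>R a - q *\<^sub>R b \<in> C 2" using C_first_step[OF a b] by blast
      then have "(z - p *\<^sub>R a - q *\<^sub>R b) + (p *\<^sub>R a + q *\<^sub>R b) \<in> K i"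
        using C2K[of i] i by (intro subspace_add subspace_scale subK aK bK) auto
      then show ?thesis by simp
    qed
    then show False using proper[OF i] by auto
  qed
  have "finite {t. a + t *\<^sub>R b \<in> K i}" if "2 \<le> i" "i \<le> n - 2" for i
  proof (cases "{t. a + t *\<^sub>R b \<in> K i} = {}")
    case False
    then obtain s where "a + s *\<^sub>R b \<in> K i" by auto
    then have "{t. a + t *\<^sub>R b \<in> K i} \<subseteq> {s}" using unique[OF that] by auto
    then show ?thesis by (rule finite_subset) simp
  qed simp
  then have "finite (\<Union>i\<in>{2..n - 2}. {t. a + t *\<^sub>R b \<in> K i})" by auto
  then obtain t where "t \<notin> (\<Union>i\<in>{2..n - 2}. {t. a + t *\<^sub>R b \<in> K i})"
    using ex_new_if_finite infinite_UNIV_char_0 by blast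
  then have t: "a + t *\<^sub>R b \<notin> K i" if "2 \<le> i" "i \<le> n - 2" for i using that by auto
  show thesis
  proof (rule that[of "a + t *\<^sub>R b"])
    have "2 \<le> n - 2" using n_ge by simp
    then show "a + t *\<^sub>R b \<notin> C 2" using t[of 2] C2K[of 2] by auto
    show "br (a + t *\<^sub>R b) u \<notin> C (Suc (Suc i))"
      if i: "2 \<le> i" "i \<le> n - 2" and u: "u \<in> C i" "u \<notin> C (Suc i)" for i u
    proof
      assume br_u: "br (a + t *\<^sub>R b) u \<in> C (Suc (Suc i))"
      have "br (a + t *\<^sub>R b) y \<in> C (Suc (Suc i))" if y: "y \<in> C i" for y
      proof -
        have "i < n" using i n_ge by simp
        then obtain r where "y - r *\<^sub>R u \<in> C (Suc i)" using C_one_step[of i u y] i u y by blast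
        then have "br (a + t *\<^sub>R b) (y - r *\<^sub>R u) \<in> C (Suc (Suc i))" by (intro br_C) auto
        then have "br (a + t *\<^sub>R b) (y - r *\<^sub>R u) + r *\<^sub>R br (a + t *\<^sub>R b) u \<in> C (Suc (Suc i))"
          using br_u by (intro subspace_add subspace_scale subspace_C) auto
        then show ?thesis by (simp add: br_diff(2) br_scaleR(2))
      qed
      then show False using t[OF i] by (auto simp: K_def)
    qed
  qed
qed

lemma exists_frame:
  assumes n: "n = 2 * k"
  shows "\<exists>e. filiform_frame n e br k \<and> br (e 2) (e 3) \<in> filtration n e 5"
proof -
  obtain x where x: "x \<notin> C 2"
    and generic: "\<And>i u. 2 \<le> i \<Longrightarrow> i \<le> n - 2 \<Longrightarrow> u \<in> C i \<Longrightarrow> u \<notin> C (Suc i) \<Longrightarrow> br x u \<notin> C (Suc (Suc i))"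
    using exists_generic by blast
  obtain y where y: "y \<notin> span (insert x (C 2))" using C_two_codim by blast
  have sub3: "subspace (C 3)" by (rule subspace_C) simp
  have xy: "br x y \<in> C 2" using br_C[of 1 y x] C_one by (simp add: numeral_2_eq_2)
  have xy3: "br x y \<notin> C 3"
  proof
    assume xy: "br x y \<in> C 3"
    have "br z w \<in> C 3" for z w
    proof -
      obtain a b where ab: "z - a *\<^sub>R x - b *\<^sub>R y \<in> C 2" using C_first_step[OF x y] by blast
      obtain c d where cd: "w - c *\<^sub>R x - d *\<^sub>R y \<in> C 2" using C_first_step[OF x y] by blast
      have "br (z - a *\<^sub>R x - b *\<^sub>R y) w \<in> C 3" "br x (w - c *\<^sub>R x - d *\<^sub>R y) \<in> C 3"
        "br y (w - c *\<^sub>R x - d *\<^sub>R y) \<in> C 3"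
        using br_C'[OF _ ab, of w] br_C[OF _ cd] by simp_all
      \<comment> \<open>Modulo \<open>C 3\<close> the bracket depends only on classes modulo
        \<open>C 2\<close>, hence it is a determinant times \<open>[x, y]\<close>.\<close>
      then have "br (z - a *\<^sub>R x - b *\<^sub>R y) w + (a *\<^sub>R br x (w - c *\<^sub>R x - d *\<^sub>R y)
          + b *\<^sub>R br y (w - c *\<^sub>R x - d *\<^sub>R y) + (a * d - b * c) *\<^sub>R br x y) \<in> C 3"
        by (intro subspace_add subspace_scale sub3 xy)
      moreover have "br (z - a *\<^sub>R x - b *\<^sub>R y) w + (a *\<^sub>R br x (w - c *\<^sub>R x - d *\<^sub>R y)
          + b *\<^sub>R br y (w - c *\<^sub>R x - d *\<^sub>R y) + (a * d - b * c) *\<^sub>R br x y) = br z w"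
        by (simp add: br_add br_diff br_scaleR br_self br_skew[of y x] algebra_simps)
      ultimately show ?thesis by simp
    qed
    then have "C 2 \<subseteq> C 3"
      using C_Suc[of 1] span_minimal[OF _ sub3, of "{br x y | x y. y \<in> C 1}"]
      by (auto simp: numeral_2_eq_2)
    then show False using C_strict[of 2] n_ge by simp
  qed
  have "br x (br x y) \<in> C 3" "br x (br x y) \<notin> C 4" "br y (br x y) \<in> C 3"
    using br_C[of 2 "br x y"] xy generic[of 2 "br x y"] xy3 n_ge br_C[of 2 "br x y" y] by simp_all
  then obtain r where r: "br y (br x y) - r *\<^sub>R br x (br x y) \<in> C 4"
    using C_one_step[of 3 "br x (br x y)" "br y (br x y)"] n_ge by auto
  \<comment> \<open>Subtracting a multiple of \<open>x\<close> keeps \<open>[x, y]\<close> and moves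
    the bracket of the second generator with it into \<open>C 4\<close>, which will be the
    filtration step 5. This makes \<open>d 2 3\<close> zero.\<close>
  define y' where "y' = y - r *\<^sub>R x"
  have xy': "br x y' = br x y" by (simp add: y'_def br_diff br_scaleR br_self)
  have y': "y' \<notin> span (insert x (C 2))"
  proof
    assume "y' \<in> span (insert x (C 2))"
    then have "y' + r *\<^sub>R x \<in> span (insert x (C 2))"
      by (intro span_add span_scale) (auto intro: span_base)
    then show False using y by (simp add: y'_def)
  qed
  define e where "e i = (if i = 1 then x else (br x ^^ (i - 2)) y')" for i
  have e12: "e 1 = x" "e 2 = y'" by (simp_all add: e_def)
  have e_Suc: "e (Suc i) = br x (e i)" if i: "2 \<le> i" for i
  proof -
    obtain m where "i = 2 + m" using le_Suc_ex[OF i] by blast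
    then show ?thesis by (simp add: e_def)
  qed
  have e3: "e 3 = br x y" using e_Suc[of 2] e12 xy' by simp
  have e_C: "e i \<in> C (i - 1)" if "3 \<le> i" for i
    using that
  proof (induction i rule: nat_induct_at_least)
    case base
    then show ?case using e3 xy by simp
  next
    case (Suc i)
    then show ?case using br_C[of "i - 1" "e i" x] e_Suc[of i] by simp
  qed
  have e_not_C: "e i \<notin> C i" if "3 \<le> i" "i \<le> n" for i
    using that
  proof (induction i rule: nat_induct_at_least)
    case base
    then show ?case using e3 xy3 by simp
  next
    case (Suc i)
    then show ?case using generic[of "i - 1" "e i"] e_C[of i] e_Suc[of i] by simp
  qed
  \<comment> \<open>The index is off by one because \<open>e 1\<close> and \<open>e 2\<close> both
    have degree 1; for \<open>p = Suc n\<close> both sides are zero.\<close>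
  have filtration_C: "filtration n e p = C (p - 1)" if p: "3 \<le> p" "p \<le> Suc n" for p
  proof
    show "filtration n e p \<subseteq> C (p - 1)"
      unfolding filtration_def
    proof (rule span_minimal)
      show "subspace (C (p - 1))" using p by (intro subspace_C) simp
      show "e ` {p..n} \<subseteq> C (p - 1)"
      proof (intro image_subsetI)
        fix i assume i: "i \<in> {p..n}"
        then have "C (i - 1) \<subseteq> C (p - 1)" using p by (intro C_antimono) auto
        then show "e i \<in> C (p - 1)" using e_C[of i] i p by auto
      qed
    qed
    show "C (p - 1) \<subseteq> filtration n e p"
      using p(2,1)
    proof (induction p rule: inc_induct)
      case base
      then show ?case using C_top by (simp add: filtration_def)
    next
      case (step p)
      show ?case
      proof
        fix z assume z: "z \<in> C (p - 1)"
        have "\<exists>a. z - a *\<^sub>R e p \<in> C (Suc (p - 1))"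
          using step z e_C[of p] e_not_C[of p] by (intro C_one_step) auto
        then obtain a where "z - a *\<^sub>R e p \<in> filtration n e (Suc p)" using step by auto
        moreover have "filtration n e (Suc p) \<subseteq> filtration n e p"
          unfolding filtration_def by (intro span_mono image_mono) auto
        ultimately have "z - a *\<^sub>R e p \<in> filtration n e p" by blast
        moreover have "a *\<^sub>R e p \<in> filtration n e p"
          using step unfolding filtration_def by (intro span_scale span_base) auto
        ultimately have "(z - a *\<^sub>R e p) + a *\<^sub>R e p \<in> filtration n e p"
          unfolding filtration_def by (rule span_add)
        then show "z \<in> filtration n e p" by simp
      qed
    qed
  qed
  have span: "span (e ` {1..n}) = UNIV"
  proof -
    have "z \<in> span (e ` {1..n})" for z
    proof -
      obtain a b where "z - a *\<^sub>R x - b *\<^sub>R y' \<in> C 2" using C_first_step[OF x y'] by blast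
      then have "z - a *\<^sub>R e 1 - b *\<^sub>R e 2 \<in> span (e ` {3..n})"
        using filtration_C[of 3] n_ge e12 by (simp add: filtration_def)
      moreover have "span (e ` {3..n}) \<subseteq> span (e ` {1..n})"
        by (intro span_mono image_mono) auto
      ultimately have "z - a *\<^sub>R e 1 - b *\<^sub>R e 2 \<in> span (e ` {1..n})" by blast
      moreover have "a *\<^sub>R e 1 + b *\<^sub>R e 2 \<in> span (e ` {1..n})"
        using n_ge by (intro span_add span_scale span_base imageI) auto
      ultimately have "(z - a *\<^sub>R e 1 - b *\<^sub>R e 2) + (a *\<^sub>R e 1 + b *\<^sub>R e 2) \<in> span (e ` {1..n})"
        by (rule span_add)
      then show ?thesis by simp
    qed
    then show ?thesis by auto
  qed
  \<comment> \<open>A basis extracted from these spanning vectors has \<open>n\<close> elements by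
    the dimension assumption, so nothing is dropped and no two of them coincide.\<close>
  have is_basis: "is_basis n e"
  proof -
    obtain B where B: "B \<subseteq> e ` {1..n}" "independent B" "e ` {1..n} \<subseteq> span B"
      using maximal_independent_subset[of "e ` {1..n}"] by metis
    have "span B = UNIV"
      using span span_minimal[OF B(3)] by auto
    then have "card B = n" using dim_eq_card[of B UNIV] B(2) dim_UNIV by simp
    moreover have "card (e ` {1..n}) \<le> n" using card_image_le[of "{1..n}" e] by simp
    ultimately have "B = e ` {1..n}" "card (e ` {1..n}) = n"
      using card_seteq[of "e ` {1..n}" B] B(1) by auto
    then show ?thesis
      using B(2) span by (auto simp: is_basis_def intro: eq_card_imp_inj_on)
  qed
  have "filiform_frame n e br k"
  proof
    show "is_basis n e" "n = 2 * k" "lie_algebra br" using is_basis n filiform by (simp_all add: filiform_def)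
    show "2 \<le> k" using n n_ge by simp
    show "br (e 1) (e i) = e (Suc i)" if "2 \<le> i" "i < n" for i
      using e_Suc[of i] that e12 by simp
    show "br (e 1) (e n) = 0"
      using br_C[OF _ e_C[of n], of "e 1"] C_top n_ge by simp
    show "br (e i) (e j) \<in> filtration n e (i + j - 1)"
      if ij: "2 \<le> i" "i \<le> n" "2 \<le> j" "j \<le> n" for i j
    proof -
      have e_C': "e i \<in> C (i - 1)" if "2 \<le> i" for i
        using e_C[of i] that C_one by (cases "i = 2") auto
      have "br (e i) (e j) \<in> C (i - 1 + (j - 1))"
        using ij e_C' by (intro br_C_C) auto
      also have "i - 1 + (j - 1) = i + j - 1 - 1" using ij by simp
      finally have br: "br (e i) (e j) \<in> C (i + j - 1 - 1)" .
      show ?thesis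
      proof (cases "i + j - 1 \<le> Suc n")
        case True
        then show ?thesis using br filtration_C[of "i + j - 1"] ij by simp
      next
        case False
        then have "C (i + j - 1 - 1) \<subseteq> C n" using n_ge by (intro C_antimono) auto
        then have "br (e i) (e j) = 0" using br C_top by blast
        then show ?thesis by (simp add: filtration_def span_zero)
      qed
    qed
  qed
  moreover have "br (e 2) (e 3) \<in> filtration n e 5"
    using filtration_C[of 5] n_ge r by (simp add: e12 e3 y'_def br_diff br_scaleR)
  ultimately show ?thesis by blast
qed

end

section \<open>The associated graded algebra\<close>

context basis_family
begin

lemma wedge_sum_basis:
  assumes S: "S \<subseteq> {(i, j). 1 \<le> i \<and> i < j \<and> j \<le> n}" and ab: "a \<in> {1..n}" "b \<in> {1..n}"
  shows "(\<Sum>(i, j)\<in>S. \<beta> i j * wedge (co i) (co j) (e a) (e b))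
    = (if (a, b) \<in> S then \<beta> a b else if (b, a) \<in> S then - \<beta> b a else 0)"
proof -
  have fin: "finite S"
    by (rule finite_subset[of _ "{1..n} \<times> {1..n}"]) (use S in auto)
  have "(\<Sum>(i, j)\<in>S. \<beta> i j * wedge (co i) (co j) (e a) (e b))
      = (\<Sum>p\<in>S. (if p = (a, b) then \<beta> a b else 0) - (if p = (b, a) then \<beta> b a else 0))"
  proof (intro sum.cong refl)
    fix p assume "p \<in> S"
    then obtain i j where "p = (i, j)" "1 \<le> i" "i < j" "j \<le> n" using S by auto
    then show "(case p of (i, j) \<Rightarrow> \<beta> i j * wedge (co i) (co j) (e a) (e b))
        = (if p = (a, b) then \<beta> a b else 0) - (if p = (b, a) then \<beta> b a else 0)"
      using ab by (auto simp: wedge_def co_basis)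
  qed
  also have "\<dots> = (if (a, b) \<in> S then \<beta> a b else 0) - (if (b, a) \<in> S then \<beta> b a else 0)"
    using fin by (simp add: sum_subtractf sum.delta)
  also have "\<dots> = (if (a, b) \<in> S then \<beta> a b else if (b, a) \<in> S then - \<beta> b a else 0)"
  proof -
    have "i < j" if "(i, j) \<in> S" for i j using subsetD[OF S that] by simp
    then have "\<not> ((a, b) \<in> S \<and> (b, a) \<in> S)" using less_asym by blast
    then show ?thesis by auto
  qed
  finally show ?thesis .
qed

lemma bilinear_wedge_sum: "bilinear (\<lambda>x y. \<Sum>(i, j)\<in>S. \<beta> i j * wedge (co i) (co j) x y)"
  unfolding bilinear_def split_def
  by (intro conjI allI linear_compose_sum ballI)
    (simp_all add: linear_iff wedge_def co_add co_scaleR algebra_simps)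

end

locale adapted_frame = filiform_frame +
  assumes adapted: "adapted_basis n br e"
begin

abbreviation gr :: "'a \<Rightarrow> 'a \<Rightarrow> 'a" where "gr \<equiv> assoc_graded n br e"

definition gc :: "nat \<Rightarrow> nat \<Rightarrow> real" where "gc i j = co (i + j) (br (e i) (e j))"

lemma gr_eq: "gr = graded_bracket n e gc"
  by (simp add: assoc_graded_def gc_def[abs_def])

lemma bilinear_gr: "bilinear gr"
  unfolding gr_eq by (rule bilinear_graded_bracket)

lemma gr_basis: "i \<in> {1..n} \<Longrightarrow> j \<in> {1..n} \<Longrightarrow> gr (e i) (e j) = (if i + j \<le> n then gc i j *\<^sub>R e (i + j) else 0)"
  unfolding gr_eq by (rule graded_bracket_basis)

lemma adapted_filtered: "i \<in> {1..n} \<Longrightarrow> j \<in> {1..n} \<Longrightarrow> br (e i) (e j) \<in> filtration n e (i + j)"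
  using adapted by (simp add: adapted_basis_def)

lemma gc_skew: "gc j i = - gc i j"
  using br_skew[of "e j" "e i"] by (simp add: gc_def co_minus add.commute)

lemma gc_one: "2 \<le> j \<Longrightarrow> j < n \<Longrightarrow> gc 1 j = 1"
  using shift[of j] by (simp add: gc_def co_basis)

lemma co_adapted_zero:
  "i \<in> {1..n} \<Longrightarrow> j \<in> {1..n} \<Longrightarrow> w \<in> {1..n} \<Longrightarrow> w < i + j \<Longrightarrow> co w (br (e i) (e j)) = 0"
  using adapted_filtered[of i j] by (auto simp: filtration_iff)

lemma d_zero_adapted: "d 2 3 = 0" "d 2 (n - 1) = 0"
  using co_adapted_zero[of 2 3 4] co_adapted_zero[of 2 "n - 1" n] n_ge by (auto simp: d_def)

text \<open>The coefficient of \<open>e_(i+j+l)\<close> in the Jacobi identity of \<open>br\<close>: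
  the further terms of an inner bracket contribute only to higher weights.\<close>

lemma gc_jacobi:
  assumes "1 \<le> i" "1 \<le> j" "1 \<le> l" "i + j + l \<le> n"
  shows "gc j l * gc i (j + l) + gc l i * gc j (l + i) + gc i j * gc l (i + j) = 0"
proof -
  define w where "w = i + j + l"
  have lead: "co w (br (e a) (br (e b) (e m))) = gc b m * gc a (b + m)"
    if abm: "1 \<le> a" "1 \<le> b" "1 \<le> m" "a + b + m = w" for a b m
  proof -
    have "co w (br (e a) (br (e b) (e m)))
        = co a (e a) * co (b + m) (br (e b) (e m)) * co w (br (e a) (e (b + m)))"
    proof (rule bilinear_leading[OF bilinear_co_br])
      show "e a \<in> filtration n e a"
        by (rule basis_in_filtration) (use abm assms w_def in auto)
      show "br (e b) (e m) \<in> filtration n e (b + m)"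
        by (rule adapted_filtered) (use abm assms w_def in auto)
      show "co w (br (e i') (e j')) = 0"
        if "a \<le> i'" "i' \<le> n" "b + m \<le> j'" "j' \<le> n" "a + (b + m) < i' + j'" for i' j'
        by (rule co_adapted_zero) (use that abm assms w_def in auto)
    qed (use abm assms w_def in auto)
    moreover have "co a (e a) = 1" using abm assms w_def by (simp add: co_basis)
    moreover have "a + (b + m) = w" using abm by simp
    ultimately show ?thesis by (simp add: gc_def)
  qed
  have "co w (br (e i) (br (e j) (e l)) + br (e j) (br (e l) (e i)) + br (e l) (br (e i) (e j))) = 0"
    unfolding br_jacobi by (rule co_zero)
  then show ?thesis
    using lead[of i j l] lead[of j l i] lead[of l i j] assms by (simp add: co_add w_def)
qed

lemma gr_gr_basis:
  assumes "i \<in> {1..n}" "j \<in> {1..n}" "l \<in> {1..n}"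
  shows "gr (e i) (gr (e j) (e l)) = (if i + j + l \<le> n then (gc j l * gc i (j + l)) *\<^sub>R e (i + j + l) else 0)"
  using assms by (auto simp: gr_basis bilinear_rmul[OF bilinear_gr] bilinear_rzero[OF bilinear_gr] add.assoc)

lemma lie_gr: "lie_algebra gr"
proof -
  have "gr x x = 0" for x
  proof -
    have "gr x x = - gr x x"
    proof (rule bilinear_eq_basis[of gr "\<lambda>x y. - gr y x"])
      show "bilinear (\<lambda>x y. - gr y x)"
        using bilinear_gr by (auto simp: bilinear_def linear_iff)
      show "gr (e i) (e j) = - gr (e j) (e i)" if "i \<in> {1..n}" "j \<in> {1..n}" for i j
        using that gc_skew[of i j] by (simp add: gr_basis add.commute)
    qed (rule bilinear_gr)
    then have "2 *\<^sub>R gr x x = 0" by (simp add: scaleR_2 add_eq_0_iff)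
    then show ?thesis by simp
  qed
  moreover have "gr x (gr y z) + gr y (gr z x) + gr z (gr x y) = 0" for x y z
  proof (rule trilinear_zero_basis[of "\<lambda>x y z. gr x (gr y z) + gr y (gr z x) + gr z (gr x y)"])
    fix i j l assume ijl: "i \<in> {1..n}" "j \<in> {1..n}" "l \<in> {1..n}"
    show "gr (e i) (gr (e j) (e l)) + gr (e j) (gr (e l) (e i)) + gr (e l) (gr (e i) (e j)) = 0"
    proof (cases "i + j + l \<le> n")
      case True
      then have "(gc j l * gc i (j + l) + gc l i * gc j (l + i) + gc i j * gc l (i + j)) *\<^sub>R e (i + j + l) = 0"
        using gc_jacobi[of i j l] ijl by simp
      then show ?thesis
        using True ijl by (simp add: gr_gr_basis scaleR_add_left add_ac)
    next
      case False
      then show ?thesis using ijl by (simp add: gr_gr_basis add_ac)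
    qed
  qed (use bilinear_gr in \<open>auto simp: bilinear_def linear_iff scaleR_add_right\<close>)
  ultimately show ?thesis
    using bilinear_gr by (simp add: lie_algebra_def)
qed

lemma dim_basis: "dim (UNIV :: 'a set) = n"
proof -
  have "dim (UNIV :: 'a set) = dim (span (e ` {1..n}))" by (simp only: span_basis)
  also have "\<dots> = card (e ` {1..n})" by (rule dim_span_eq_card_independent[OF independent_basis])
  also have "\<dots> = n" using card_image[OF inj_basis] by simp
  finally show ?thesis .
qed

lemma gr_filtered:
  assumes "x \<in> filtration n e p" "y \<in> filtration n e q" "1 \<le> p" "1 \<le> q"
  shows "gr x y \<in> filtration n e (p + q)"
proof (rule bilinear_filtered[OF bilinear_gr filtration_subspace assms(1,2)])
  fix i j assume ij: "p \<le> i" "i \<le> n" "q \<le> j" "j \<le> n"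
  then show "gr (e i) (e j) \<in> filtration n e (p + q)"
    using assms subspace_0[OF filtration_subspace]
      subspace_scale[OF filtration_subspace basis_in_filtration[of "p + q" "i + j"]]
    by (auto simp: gr_basis)
qed

text \<open>The first bracket gains two filtration steps, as the only basis product of weight 2 is
  \<open>[e_1, e_1] = 0\<close>; each later one gains one.\<close>

lemma central_seq_gr_upper: "central_seq gr (Suc (Suc m)) \<subseteq> filtration n e (m + 3)"
proof (induction m)
  case 0
  have "gr x y \<in> filtration n e 3" for x y
  proof (rule bilinear_filtered[OF bilinear_gr filtration_subspace, of x 1 y 1])
    show "x \<in> filtration n e 1" "y \<in> filtration n e 1" by (simp_all add: filtration_one)
    fix i j assume ij: "1 \<le> i" "i \<le> n" "1 \<le> j" "j \<le> n"
    have "gr (e 1) (e 1) = 0" using lie_gr by (simp add: lie_algebra_def)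
    moreover have "gr (e i) (e j) \<in> filtration n e (i + j)"
      using ij by (intro gr_filtered basis_in_filtration) auto
    then have "gr (e i) (e j) \<in> filtration n e 3" if "3 \<le> i + j"
      using filtration_antimono[OF that] by auto
    moreover have "3 \<le> i + j \<or> i = 1 \<and> j = 1" using ij by auto
    ultimately show "gr (e i) (e j) \<in> filtration n e 3"
      using subspace_0[OF filtration_subspace] by auto
  qed
  then show ?case
    using span_minimal[OF _ filtration_subspace, of "{gr x y | x y. y \<in> UNIV}" 3]
    by (auto simp: central_seq.simps)
next
  case (Suc m)
  have "gr x y \<in> filtration n e (Suc m + 3)" if "y \<in> central_seq gr (Suc (Suc m))" for x y
    using gr_filtered[of x 1 y "m + 3"] that Suc filtration_one[of 1] by auto
  then show ?case
    unfolding central_seq.simps(3)[of gr "Suc m"] by (intro span_minimal filtration_subspace) blast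
qed

lemma central_seq_gr_lower: "m + 3 \<le> n \<Longrightarrow> e (m + 3) \<in> central_seq gr (Suc (Suc m))"
proof (induction m)
  case 0
  have "gr (e 1) (e 2) = e (0 + 3)" using gr_basis[of 1 2] gc_one[of 2] 0 by (simp add: numeral_3_eq_3)
  moreover have "gr (e 1) (e 2) \<in> central_seq gr (Suc (Suc 0))"
    unfolding central_seq.simps by (rule span_base) blast
  ultimately show ?case by simp
next
  case (Suc m)
  have "gr (e 1) (e (m + 3)) = e (Suc m + 3)"
    using gr_basis[of 1 "m + 3"] gc_one[of "m + 3"] Suc by simp
  moreover have "e (m + 3) \<in> central_seq gr (Suc (Suc m))" using Suc by simp
  then have "gr (e 1) (e (m + 3)) \<in> central_seq gr (Suc (Suc (Suc m)))"
    unfolding central_seq.simps(3)[of gr "Suc m"] by (intro span_base) blast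
  ultimately show ?case by simp
qed

lemma basis_nonzero: "i \<in> {1..n} \<Longrightarrow> e i \<noteq> 0"
  using co_basis[of i i] by (auto simp: co_zero)

lemma filiform_gr: "filiform n gr"
proof -
  have eq: "Suc (Suc (n - 3)) = n - 1" "n - 3 + 3 = n" "Suc (Suc (n - 2)) = n" "n - 2 + 3 = n + 1"
    using n_ge by auto
  have "e n \<in> central_seq gr (n - 1)" and sub: "central_seq gr n \<subseteq> filtration n e (n + 1)"
    using central_seq_gr_lower[of "n - 3"] central_seq_gr_upper[of "n - 2"] unfolding eq by simp_all
  moreover have "0 \<in> central_seq gr (Suc (Suc (n - 2)))"
    unfolding central_seq.simps by (rule span_zero)
  then have "0 \<in> central_seq gr n" unfolding eq .
  moreover have "e n \<noteq> 0" using basis_nonzero n_ge by simp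
  moreover have "filtration n e (n + 1) = {0}" by (rule filtration_top) simp
  ultimately have "central_seq gr n = {0}" "central_seq gr (n - 1) \<noteq> {0}" by blast+
  then show ?thesis
    using lie_gr dim_basis by (simp add: filiform_def)
qed

lemma nat_graded_gr: "nat_graded_filiform n gr"
proof -
  define G where "G i = (if i \<in> {1..n} then span {e i} else {0})" for i
  have G_iff: "x \<in> G i \<longleftrightarrow> (\<exists>a. x = a *\<^sub>R e i)" if "i \<in> {1..n}" for x i
    using that by (auto simp: G_def span_singleton)
  have G_out: "G i = {0}" if "i \<notin> {1..n}" for i using that by (auto simp: G_def)
  have sub: "subspace (G i)" for i
    by (auto simp: G_def subspace_single_0)
  have dimG: "dim (G i) = 1" if "i \<in> {1..n}" for i
  proof -
    have "independent {e i}" using basis_nonzero[OF that] by (simp add: independent_insert independent_empty)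
    then show ?thesis using that by (simp add: G_def dim_eq_card_independent)
  qed
  have decomp: "\<exists>!f. (\<forall>i. f i \<in> G i) \<and> x = (\<Sum>i=1..n. f i)" for x
  proof (rule ex1I[of _ "\<lambda>i. if i \<in> {1..n} then co i x *\<^sub>R e i else 0"])
    show "(\<forall>i. (if i \<in> {1..n} then co i x *\<^sub>R e i else 0) \<in> G i) \<and>
        x = (\<Sum>i=1..n. if i \<in> {1..n} then co i x *\<^sub>R e i else 0)"
    proof
      have "(\<Sum>i=1..n. if i \<in> {1..n} then co i x *\<^sub>R e i else 0) = (\<Sum>i=1..n. co i x *\<^sub>R e i)"
        by (intro sum.cong) auto
      then show "x = (\<Sum>i=1..n. if i \<in> {1..n} then co i x *\<^sub>R e i else 0)"
        by (simp only: expansion)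
    qed (use G_iff G_out in auto)
    fix f assume f: "(\<forall>i. f i \<in> G i) \<and> x = (\<Sum>i=1..n. f i)"
    have "\<forall>i\<in>{1..n}. \<exists>r. f i = r *\<^sub>R e i"
      using f G_iff by blast
    then have "\<exists>a. \<forall>i\<in>{1..n}. f i = a i *\<^sub>R e i" by (rule bchoice)
    then obtain a where a: "\<And>i. i \<in> {1..n} \<Longrightarrow> f i = a i *\<^sub>R e i" by blast
    have "co i x = a i" if i: "i \<in> {1..n}" for i
    proof -
      have "co i x = (\<Sum>j=1..n. co i (f j))" using f by (simp add: co_sum)
      also have "\<dots> = (\<Sum>j=1..n. if j = i then a i else 0)"
        using i by (intro sum.cong refl) (auto simp: a co_scaleR co_basis)
      finally show ?thesis using i by simp
    qed
    moreover have "f i = 0" if "i \<notin> {1..n}" for i using f G_out[OF that] by blast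
    ultimately show "f = (\<lambda>i. if i \<in> {1..n} then co i x *\<^sub>R e i else 0)"
      using a by (simp add: fun_eq_iff del: atLeastAtMost_iff)
  qed
  have graded: "gr x y \<in> G (i + j)" if ij: "1 \<le> i" "1 \<le> j" "x \<in> G i" "y \<in> G j" for i j x y
  proof (cases "i \<le> n \<and> j \<le> n")
    case True
    then obtain a b where "x = a *\<^sub>R e i" "y = b *\<^sub>R e j" using G_iff ij by auto
    then have "gr x y = (a * b) *\<^sub>R gr (e i) (e j)"
      by (simp add: bilinear_lmul[OF bilinear_gr] bilinear_rmul[OF bilinear_gr])
    then show ?thesis
      using True ij G_iff[of "i + j"] subspace_0[OF sub] by (auto simp: gr_basis)
  next
    case False
    then have "x = 0 \<or> y = 0" using ij G_out[of i] G_out[of j] by auto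
    then show ?thesis
      using subspace_0[OF sub] by (auto simp: bilinear_lzero[OF bilinear_gr] bilinear_rzero[OF bilinear_gr])
  qed
  have generated: "span {gr x y | x y. x \<in> G 1 \<and> y \<in> G i} = G (i + 1)" if i: "2 \<le> i" for i
  proof
    show "span {gr x y | x y. x \<in> G 1 \<and> y \<in> G i} \<subseteq> G (i + 1)"
      using graded[of 1 i] i sub by (intro span_minimal) (auto simp: add.commute)
    show "G (i + 1) \<subseteq> span {gr x y | x y. x \<in> G 1 \<and> y \<in> G i}"
    proof
      fix z assume z: "z \<in> G (i + 1)"
      show "z \<in> span {gr x y | x y. x \<in> G 1 \<and> y \<in> G i}"
      proof (cases "i < n")
        case True
        then obtain a where a: "z = a *\<^sub>R e (i + 1)" using G_iff[of "i + 1"] z i by auto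
        have "gr (e 1) (a *\<^sub>R e i) = z"
          using gr_basis[of 1 i] gc_one[of i] True i a by (simp add: bilinear_rmul[OF bilinear_gr])
        moreover have "e 1 \<in> G 1" "a *\<^sub>R e i \<in> G i"
          using True i by (auto simp: G_def intro: span_base span_scale)
        ultimately show ?thesis by (intro span_base) blast
      next
        case False
        then have "z = 0" using z G_out[of "i + 1"] by simp
        then show ?thesis by (simp add: span_zero)
      qed
    qed
  qed
  show ?thesis
    unfolding nat_graded_filiform_def
    by (intro conjI filiform_gr exI[of _ G]) (use sub dimG G_out decomp graded generated in blast)+
qed

text \<open>Scaling \<open>e_2, ..., e_n\<close> by a common factor keeps
  \<open>[e_1, e_i] = e_(i+1)\<close> and multiplies the constants with \<open>i, j \<ge> 2\<close>
  by that factor.\<close>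

lemma isomorphic_scaled:
  assumes b: "b \<noteq> 0" and one: "\<And>j. 2 \<le> j \<Longrightarrow> j < n \<Longrightarrow> c' 1 j = 1"
    and eq: "\<And>i j. 2 \<le> i \<Longrightarrow> i < j \<Longrightarrow> i + j \<le> n \<Longrightarrow> gc i j = b * c' i j"
  shows "lie_isomorphic gr (graded_bracket n e (skew c'))"
  unfolding gr_eq
proof (rule graded_bracket_isomorphic[of "\<lambda>i. if i = 1 then 1 else b"])
  fix i j :: nat assume ij: "1 \<le> i" "1 \<le> j" "i + j \<le> n"
  have lt: "(if i + j = 1 then 1 else b) * gc i j =
      (if i = 1 then 1 else b) * (if j = 1 then 1 else b) * skew c' i j" if "1 \<le> i" "i < j" "i + j \<le> n" for i j
  proof (cases "i = 1")
    case True
    then show ?thesis using that one[of j] gc_one[of j] by (simp add: skew_def)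
  next
    case False
    then show ?thesis using that eq[of i j] by (simp add: skew_def)
  qed
  have "i < j \<or> j < i \<or> i = j" by auto
  moreover have "skew c' i j = - skew c' j i" by (auto simp: skew_def)
  moreover have "gc i i = 0" using gc_skew[of i i] by simp
  moreover have "skew c' i i = 0" by (simp add: skew_def)
  ultimately show "(if i + j = 1 then 1 else b) * gc i j =
      (if i = 1 then 1 else b) * (if j = 1 then 1 else b) * skew c' i j"
    using lt[of i j] lt[of j i] ij gc_skew[of j i] by (auto simp: add.commute mult.commute)
qed (use b in auto)

text \<open>The factorials undo the normalisation in \<open>witt_coeff\<close>: the coefficient of
  \<open>[e_1, e_j]\<close> in the Witt basis is \<open>j - 1\<close>, the quotient of two
  consecutive factors.\<close>

lemma isomorphic_V:
  assumes b: "b \<noteq> 0"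
    and eq: "\<And>i j. 2 \<le> i \<Longrightarrow> 2 \<le> j \<Longrightarrow> i + j \<le> n \<Longrightarrow> gc i j = b * witt_coeff i j"
  shows "lie_isomorphic gr (V_bracket n e)"
  unfolding gr_eq V_bracket_def
proof (rule graded_bracket_isomorphic[of "\<lambda>i. if i = 1 then 1 else b * fact (i - 2)"])
  fix i j :: nat assume ij: "1 \<le> i" "1 \<le> j" "i + j \<le> n"
  have one: "b * fact (Suc j - 2) * gc 1 j = b * fact (j - 2) * (real j - 1)" if j: "2 \<le> j" "Suc j \<le> n" for j
  proof -
    obtain m where "j = 2 + m" using le_Suc_ex[OF j(1)] by blast
    then show ?thesis using gc_one[of j] j by (simp add: algebra_simps)
  qed
  have "gc 1 1 = 0" using gc_skew[of 1 1] by simp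
  then show "(if i + j = 1 then 1 else b * fact (i + j - 2)) * gc i j =
      (if i = 1 then 1 else b * fact (i - 2)) * (if j = 1 then 1 else b * fact (j - 2)) * (real j - real i)"
  proof -
    consider "i = 1" "j = 1" | "i = 1" "2 \<le> j" | "2 \<le> i" "j = 1" | "2 \<le> i" "2 \<le> j"
      using ij by linarith
    then show ?thesis
    proof cases
      case 2
      then show ?thesis using one[of j] ij by (simp add: mult_ac)
    next
      case 3
      then show ?thesis using one[of i] gc_skew[of i 1] ij by (simp add: algebra_simps)
    next
      case 4
      then have "gc i j = b * ((real j - real i) * fact (i - 2) * fact (j - 2) / fact (i + j - 2))"
        using eq[of i j] ij by (simp add: witt_coeff_def)
      then show ?thesis using 4 by simp
    qed (use \<open>gc 1 1 = 0\<close> in simp)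
  qed
qed (use b in auto)

section \<open>The top weight part of a symplectic form and the classification\<close>

context
  fixes \<omega> :: "'a \<Rightarrow> 'a \<Rightarrow> real"
  assumes \<omega>: "symplectic_form br \<omega>"
begin

lemma form_high:
  assumes "i \<in> {1..n}" "j \<in> {1..n}" "n + 2 \<le> i + j"
  shows "\<omega> (e i) (e j) = 0"
proof (cases "i + j = n + 2")
  case True
  then show ?thesis
    using form_near[OF \<omega>, of i j] d_zero_adapted assms by simp
next
  case False
  then show ?thesis using form_far[OF \<omega>, of i j] assms by simp
qed

text \<open>Closedness read in weight \<open>n + 1\<close>: the further terms of each bracket pair
  to higher weight, where \<open>form_high\<close> makes the form zero.\<close>

lemma form_jacobi:
  assumes "1 \<le> i" "1 \<le> j" "1 \<le> l" "i + j + l = n + 1"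
  shows "gc i j * \<omega> (e (i + j)) (e l) + gc j l * \<omega> (e (j + l)) (e i) + gc l i * \<omega> (e (l + i)) (e j) = 0"
proof -
  have lead: "\<omega> (br (e a) (e b)) (e m) = gc a b * \<omega> (e (a + b)) (e m)"
    if abm: "1 \<le> a" "1 \<le> b" "1 \<le> m" "a + b + m = n + 1" for a b m
  proof -
    have "\<omega> (br (e a) (e b)) (e m) = co (a + b) (br (e a) (e b)) * co m (e m) * \<omega> (e (a + b)) (e m)"
    proof (rule bilinear_leading[OF bilinear_form[OF \<omega>]])
      show "br (e a) (e b) \<in> filtration n e (a + b)"
        by (rule adapted_filtered) (use abm in auto)
      show "e m \<in> filtration n e m"
        by (rule basis_in_filtration) (use abm in auto)
      show "\<omega> (e i') (e j') = 0"
        if "a + b \<le> i'" "i' \<le> n" "m \<le> j'" "j' \<le> n" "a + b + m < i' + j'" for i' j'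
        by (rule form_high) (use that abm in auto)
    qed (use abm in auto)
    then show ?thesis using abm by (simp add: gc_def co_basis)
  qed
  show ?thesis
    using form_cyclic[OF \<omega>, of "e i" "e j" "e l"] lead[of i j l] lead[of j l i] lead[of l i j] assms by simp
qed

text \<open>Otherwise one could solve a triangular system for a nonzero vector of \<open>L\<^sup>i\<close> in the kernel
  of \<open>\<omega>\<close>, where \<open>i\<close> is the largest index with a vanishing antidiagonal entry.\<close>

lemma form_antidiagonal:
  assumes "i \<in> {1..n}"
  shows "\<omega> (e i) (e (n + 1 - i)) \<noteq> 0"
  using assms
proof (induction "n - i" arbitrary: i rule: less_induct)
  case (less i)
  have above: "\<omega> (e m) (e (n + 1 - m)) \<noteq> 0" if "i < m" "m \<le> n" for m
    by (rule less.hyps) (use that less.prems in auto)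
  show ?case
  proof
    assume zero: "\<omega> (e i) (e (n + 1 - i)) = 0"
    have "\<exists>x. co i x = 1 \<and> (\<forall>j\<in>{1..n}. n + 1 - m \<le> j \<longrightarrow> \<omega> x (e j) = 0)" if "i \<le> m" "m \<le> n" for m
      using that
    proof (induction m rule: nat_induct_at_least)
      case base
      have "\<omega> (e i) (e j) = 0" if "j \<in> {1..n}" "n + 1 - i \<le> j" for j
        using zero form_high[of i j] that less.prems by (cases "j = n + 1 - i") auto
      then show ?case using less.prems by (intro exI[of _ "e i"]) (simp add: co_basis)
    next
      case (Suc m)
      then obtain x where x: "co i x = 1" "\<And>j. j \<in> {1..n} \<Longrightarrow> n + 1 - m \<le> j \<Longrightarrow> \<omega> x (e j) = 0"
        by auto
      define r where "r = \<omega> x (e (n - m)) / \<omega> (e (Suc m)) (e (n - m))"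
      have nz: "\<omega> (e (Suc m)) (e (n - m)) \<noteq> 0" using above[of "Suc m"] Suc by simp
      have "\<omega> (x - r *\<^sub>R e (Suc m)) (e j) = 0" if "j \<in> {1..n}" "n + 1 - Suc m \<le> j" for j
      proof (cases "j = n - m")
        case True
        then show ?thesis
          using nz by (simp add: bilinear_lsub[OF bilinear_form[OF \<omega>]] bilinear_lmul[OF bilinear_form[OF \<omega>]] r_def)
      next
        case False
        then have "\<omega> x (e j) = 0" "\<omega> (e (Suc m)) (e j) = 0"
          using x(2)[of j] form_high[of "Suc m" j] that Suc by auto
        then show ?thesis
          by (simp add: bilinear_lsub[OF bilinear_form[OF \<omega>]] bilinear_lmul[OF bilinear_form[OF \<omega>]])
      qed
      moreover have "co i (x - r *\<^sub>R e (Suc m)) = 1"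
        using x(1) Suc less.prems by (simp add: co_diff co_scaleR co_basis)
      ultimately show ?case by blast
    qed
    from this[of n] less.prems obtain x where x: "co i x = 1" "\<And>j. j \<in> {1..n} \<Longrightarrow> \<omega> x (e j) = 0"
      by auto
    have lin: "linear (\<omega> x)" "linear (\<lambda>y. 0 :: real)"
      using bilinear_form[OF \<omega>] by (auto simp: bilinear_def linear_iff)
    have "\<omega> x y = 0" for y
      by (rule linear_eq_basis[OF lin x(2)])
    then have "x = 0" by (rule nondegenerate[OF \<omega>])
    then show False using x(1) by (simp add: co_zero)
  qed
qed

definition top_form :: "'a \<Rightarrow> 'a \<Rightarrow> real" where
  "top_form x y = (\<Sum>(i, j)\<in>{(i, j). 1 \<le> i \<and> i < j \<and> j \<le> n \<and> i + j = n + 1}.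
     \<omega> (e i) (e j) * wedge (co i) (co j) x y)"

lemma bilinear_top_form: "bilinear top_form"
  unfolding top_form_def[abs_def] by (rule bilinear_wedge_sum)

lemma top_form_basis:
  assumes "a \<in> {1..n}" "b \<in> {1..n}"
  shows "top_form (e a) (e b) = (if a + b = n + 1 then \<omega> (e a) (e b) else 0)"
proof -
  \<comment> \<open>\<open>n + 1\<close> is odd, so the antidiagonal contains no diagonal
    entry.\<close>
  have "a \<noteq> b" if "a + b = n + 1" using that n by presburger
  moreover have "top_form (e a) (e b) = (if (a, b) \<in> {(i, j). 1 \<le> i \<and> i < j \<and> j \<le> n \<and> i + j = n + 1} then \<omega> (e a) (e b)
      else if (b, a) \<in> {(i, j). 1 \<le> i \<and> i < j \<and> j \<le> n \<and> i + j = n + 1} then - \<omega> (e b) (e a) else 0)"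
    unfolding top_form_def by (rule wedge_sum_basis) (use assms in auto)
  ultimately show ?thesis
    using assms form_skew[OF \<omega>, of "e a" "e b"] by auto
qed

lemma symplectic_top_form: "symplectic_form gr top_form"
proof -
  have lin: "linear (top_form x)" "linear (\<lambda>x. top_form x y)" for x y
    using bilinear_top_form by (auto simp: bilinear_def)
  have alternating: "two_form top_form"
    using bilinear_top_form by (auto simp: two_form_def top_form_def wedge_def)
  have cyclic: "top_form (gr x y) z + top_form (gr y z) x + top_form (gr z x) y = 0" for x y z
  proof (rule trilinear_zero_basis[of "\<lambda>x y z. top_form (gr x y) z + top_form (gr y z) x + top_form (gr z x) y"])
    fix i j l assume ijl: "i \<in> {1..n}" "j \<in> {1..n}" "l \<in> {1..n}"
    have *: "top_form (gr (e a) (e b)) (e m) = (if a + b + m = n + 1 then gc a b * \<omega> (e (a + b)) (e m) else 0)"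
      if "a \<in> {1..n}" "b \<in> {1..n}" "m \<in> {1..n}" for a b m
      using that by (auto simp: gr_basis bilinear_lmul[OF bilinear_top_form] bilinear_lzero[OF bilinear_top_form] top_form_basis)
    show "top_form (gr (e i) (e j)) (e l) + top_form (gr (e j) (e l)) (e i) + top_form (gr (e l) (e i)) (e j) = 0"
      using form_jacobi[of i j l] ijl by (auto simp: * add_ac)
  qed (use bilinear_gr lin in \<open>auto simp: bilinear_def linear_iff distrib_left\<close>)
  have "ce_differential gr top_form x y z = 0" for x y z
  proof -
    have "gr z x = - gr x z"
      by (rule alternating_skew[OF bilinear_gr]) (use lie_gr in \<open>simp add: lie_algebra_def\<close>)
    then show ?thesis
      using cyclic[of x y z] by (simp add: ce_differential_def bilinear_lneg[OF bilinear_top_form])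
  qed
  moreover have "x = 0" if x: "\<forall>y. top_form x y = 0" for x
  proof (rule co_eqI)
    fix i assume i: "i \<in> {1..n}"
    have i': "n + 1 - i \<in> {1..n}" "a + (n + 1 - i) = n + 1 \<longleftrightarrow> a = i" for a using i by auto
    \<comment> \<open>Pairing with the opposite basis vector isolates one coordinate, multiplied by
      a nonzero antidiagonal entry.\<close>
    have "top_form x (e (n + 1 - i)) = (\<Sum>a=1..n. co a x * top_form (e a) (e (n + 1 - i)))"
    proof -
      have "top_form (\<Sum>a=1..n. co a x *\<^sub>R e a) (e (n + 1 - i)) = (\<Sum>a=1..n. co a x * top_form (e a) (e (n + 1 - i)))"
        using linear_sum[OF lin(2), of "\<lambda>a. co a x *\<^sub>R e a" "{1..n}"] by (simp add: linear_scale[OF lin(2)])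
      then show ?thesis by (simp only: expansion)
    qed
    also have "\<dots> = (\<Sum>a=1..n. if a = i then co i x * \<omega> (e i) (e (n + 1 - i)) else 0)"
    proof (intro sum.cong refl)
      fix a assume a: "a \<in> {1..n}"
      show "co a x * top_form (e a) (e (n + 1 - i)) = (if a = i then co i x * \<omega> (e i) (e (n + 1 - i)) else 0)"
        unfolding top_form_basis[OF a i'(1)] i'(2) by simp
    qed
    also have "\<dots> = co i x * \<omega> (e i) (e (n + 1 - i))" using i by simp
    finally show "co i x = co i 0"
      using x form_antidiagonal[OF i] by (simp add: co_zero)
  qed
  ultimately show ?thesis using alternating by (auto simp: symplectic_form_def)
qed

lemma form_decomposition:
  "\<exists>\<omega>\<^sub>0 \<gamma>. homogeneous_two_form n e (n + 1) \<omega>\<^sub>0 \<and> symplectic_form gr \<omega>\<^sub>0 \<and>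
     (\<forall>x y. \<omega> x y = \<omega>\<^sub>0 x y +
        (\<Sum>(i, j) \<in> {(i, j). 1 \<le> i \<and> i < j \<and> j \<le> n \<and> i + j < n + 1}. \<gamma> i j * wedge (co i) (co j) x y))"
proof (intro exI conjI allI)
  show "homogeneous_two_form n e (n + 1) top_form"
    unfolding homogeneous_two_form_def top_form_def by (intro exI[of _ "\<lambda>i j. \<omega> (e i) (e j)"]) simp
  show "symplectic_form gr top_form" by (rule symplectic_top_form)
  let ?S = "{(i, j). 1 \<le> i \<and> i < j \<and> j \<le> n \<and> i + j < n + 1}"
  let ?L = "\<lambda>x y. \<Sum>(i, j)\<in>?S. \<omega> (e i) (e j) * wedge (co i) (co j) x y"
  have bil: "bilinear ?L" by (rule bilinear_wedge_sum)
  show "\<omega> x y = top_form x y + ?L x y" for x y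
  proof (rule bilinear_eq_basis[OF bilinear_form[OF \<omega>], of "\<lambda>x y. top_form x y + ?L x y"])
    show "bilinear (\<lambda>x y. top_form x y + ?L x y)"
      using bil bilinear_top_form unfolding bilinear_def by (auto intro: linear_compose_add)
    fix a b assume ab: "a \<in> {1..n}" "b \<in> {1..n}"
    have "?L (e a) (e b) = (if (a, b) \<in> ?S then \<omega> (e a) (e b) else if (b, a) \<in> ?S then - \<omega> (e b) (e a) else 0)"
      by (rule wedge_sum_basis) (use ab in auto)
    also have "\<dots> = (if a + b < n + 1 then \<omega> (e a) (e b) else 0)"
      using ab form_skew[OF \<omega>, of "e a" "e b"] form_self[OF \<omega>, of "e a"] by (cases "a = b") auto
    finally show "\<omega> (e a) (e b) = top_form (e a) (e b) + ?L (e a) (e b)"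
      using form_high[OF ab] by (auto simp: top_form_basis[OF ab])
  qed
qed

text \<open>The closed form of weight \<open>n + 1\<close> extends the structure constants by one weight: it is the
  cocycle of a central extension of \<open>gr\<close>, normalised so that \<open>[e\<^sub>1, e\<^sub>n]\<close> has coefficient 1.\<close>

definition xc :: "nat \<Rightarrow> nat \<Rightarrow> real" where
  "xc i j = (if i + j \<le> n then gc i j else \<omega> (e i) (e j) / \<omega> (e 1) (e n))"

text \<open>Up to weight \<open>n\<close> these are Jacobi identities of \<open>gr\<close>; in
  weight \<open>n + 1\<close> they are closedness of the form, divided by its value on
  \<open>e 1\<close> and \<open>e n\<close>.\<close>

lemma graded_coeffs_xc: "graded_coeffs xc (n + 1)"
proof
  have a: "\<omega> (e 1) (e n) \<noteq> 0" using form_antidiagonal[of 1] n_ge by simp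
  show "xc j i = - xc i j" for i j
    using gc_skew[of i j] form_skew[OF \<omega>, of "e i" "e j"] by (simp add: xc_def add.commute)
  show "xc (Suc i) j + xc i (Suc j) = xc i j" if ij: "2 \<le> i" "2 \<le> j" "i + j < n + 1" for i j
  proof -
    have one: "gc 1 i = 1" "gc j 1 = -1" using gc_one[of i] gc_one[of j] gc_skew[of j 1] ij by simp_all
    show ?thesis
    proof (cases "i + j = n")
      case True
      have "\<omega> (e (Suc i)) (e j) + gc i j * \<omega> (e n) (e 1) - \<omega> (e (Suc j)) (e i) = 0"
        using form_jacobi[of 1 i j] ij True one by simp
      then have "\<omega> (e (Suc i)) (e j) + \<omega> (e i) (e (Suc j)) = gc i j * \<omega> (e 1) (e n)"
        using form_skew[OF \<omega>, of "e n" "e 1"] form_skew[OF \<omega>, of "e (Suc j)" "e i"] by simp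
      then show ?thesis using a True by (simp add: xc_def field_simps)
    next
      case False
      then have "gc 1 (i + j) = 1" using gc_one[of "i + j"] ij by simp
      then have "gc i j - gc i (Suc j) + gc j (Suc i) = 0"
        using gc_jacobi[of 1 i j] ij False one by simp
      then show ?thesis using gc_skew[of j "Suc i"] False ij by (simp add: xc_def)
    qed
  qed
  show "xc i j * xc (i + j) l + xc j l * xc (j + l) i + xc l i * xc (l + i) j = 0"
    if ijl: "2 \<le> i" "2 \<le> j" "2 \<le> l" "i + j + l \<le> n + 1" for i j l
  proof (cases "i + j + l = n + 1")
    case True
    then have "xc i j * xc (i + j) l + xc j l * xc (j + l) i + xc l i * xc (l + i) j
      = (gc i j * \<omega> (e (i + j)) (e l) + gc j l * \<omega> (e (j + l)) (e i) + gc l i * \<omega> (e (l + i)) (e j)) / \<omega> (e 1) (e n)"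
      using ijl by (simp add: xc_def add_divide_distrib)
    then show ?thesis using form_jacobi[of i j l] True ijl by simp
  next
    case False
    then show ?thesis
      using gc_jacobi[of i j l] ijl gc_skew[of "i + j" l] gc_skew[of "j + l" i] gc_skew[of "l + i" j]
      by (simp add: xc_def)
  qed
qed

lemma gr_classification:
  "lie_isomorphic gr (m0_bracket n e) \<or>
   (n = 6 \<and> lie_isomorphic gr (V_bracket 6 e)) \<or>
   (k \<ge> 6 \<and> lie_isomorphic gr (V_bracket n e)) \<or>
   (n = 8 \<and> (\<exists>\<alpha>. lie_isomorphic gr (g8_bracket e \<alpha>))) \<or>
   (n = 10 \<and> (\<exists>\<alpha>. \<alpha> \<noteq> - 5 / 2 \<and> lie_isomorphic gr (g10_bracket e \<alpha>)))"
proof -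
  interpret x: graded_coeffs xc "n + 1" by (rule graded_coeffs_xc)
  have gc_xc: "gc i j = xc i j" if "i + j \<le> n" for i j using that by (simp add: xc_def)
  have a: "\<omega> (e 1) (e n) \<noteq> 0" using form_antidiagonal[of 1] n_ge by simp
  have N: "n + 1 = 2 * k + 1" using n by simp
  have nondeg: "xc i (2 * k + 1 - i) \<noteq> 0" if "2 \<le> i" "i \<le> 2 * k - 1" for i
  proof -
    have i: "i \<in> {1..n}" "\<not> i + (n + 1 - i) \<le> n" using that n by auto
    then show ?thesis
      unfolding n(1)[symmetric] using form_antidiagonal[OF i(1)] a by (simp add: xc_def)
  qed
  show ?thesis
  proof (rule x.classification[OF N n(2) nondeg])
    assume zero: "\<And>i j. 2 \<le> i \<Longrightarrow> 2 \<le> j \<Longrightarrow> i + j \<le> 2 * k \<Longrightarrow> xc i j = 0"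
    have "lie_isomorphic gr (m0_bracket n e)"
      unfolding m0_bracket_def
      by (rule isomorphic_scaled[of 1]) (use zero gc_xc n in auto)
    then show ?thesis by blast
  next
    assume k: "k = 3" and c: "xc 2 3 \<noteq> 0"
    have xc24: "xc 2 4 = xc 2 3" using x.low_weights(1) n k by simp
    \<comment> \<open>Up to weight 6 the single constant \<open>xc 2 3\<close> determines all
      others, so matching it with the Witt value 1/6 is enough.\<close>
    have "lie_isomorphic gr (V_bracket n e)"
    proof (rule isomorphic_V[of "6 * xc 2 3"])
      fix i j :: nat assume ij: "2 \<le> i" "2 \<le> j" "i + j \<le> n"
      have "(i, j) \<in> {(2, 2), (2, 3), (2, 4), (3, 2), (3, 3), (4, 2)}"
        using ij n k by auto
      then show "gc i j = 6 * xc 2 3 * witt_coeff i j"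
        using ij gc_xc[of i j] xc24 x.skew_symmetric[of 2 3] x.skew_symmetric[of 2 4] x.diagonal_zero
        by (auto simp: witt_coeff_def fact_numeral)
    qed (use c in simp)
    then show ?thesis using n k by simp
  next
    assume k: "6 \<le> k" and c: "xc 2 3 \<noteq> 0"
      and V: "\<And>i j. 2 \<le> i \<Longrightarrow> 2 \<le> j \<Longrightarrow> i + j \<le> 2 * k \<Longrightarrow> xc i j = 6 * xc 2 3 * witt_coeff i j"
    have "lie_isomorphic gr (V_bracket n e)"
    proof (rule isomorphic_V[of "6 * xc 2 3"])
      show "6 * xc 2 3 \<noteq> 0" using c by simp
      show "gc i j = 6 * xc 2 3 * witt_coeff i j" if "2 \<le> i" "2 \<le> j" "i + j \<le> n" for i j
        unfolding gc_xc[OF that(3)] by (rule V) (use that n in auto)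
    qed
    then show ?thesis using k by simp
  next
    assume k: "k = 4" and c: "xc 3 4 \<noteq> 0"
    have "6 \<le> n + 1" "7 \<le> n + 1" "8 \<le> n + 1" using n k by simp_all
    note low = x.low_weights(1)[OF this(1)] x.low_weights(2)[OF this(2)] x.low_weights(3,4)[OF this(3)]
    \<comment> \<open>The table is normalised by \<open>[e_3, e_4] = e_7\<close>, so the scaling
      factor is \<open>xc 3 4\<close>, and \<alpha> is read off from the entry
      \<open>2 + \<alpha>\<close> of \<open>[e_2, e_3]\<close>.\<close>
    define \<alpha> where "\<alpha> = xc 2 3 / xc 3 4 - 2"
    have xc23: "xc 2 3 = xc 3 4 * (2 + \<alpha>)" using c by (simp add: \<alpha>_def field_simps)
    have "lie_isomorphic gr (graded_bracket n e (skew (g8_coeff \<alpha>)))"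
    proof (rule isomorphic_scaled[OF c])
      show "g8_coeff \<alpha> 1 j = 1" for j by (simp add: g8_coeff_def)
      fix i j :: nat assume ij: "2 \<le> i" "i < j" "i + j \<le> n"
      then have "i = 2 \<or> i = 3" "j = 3 \<or> j = 4 \<or> j = 5 \<or> j = 6" using n k by auto
      then have "(i, j) \<in> {(2, 3), (2, 4), (2, 5), (2, 6), (3, 4), (3, 5)}"
        using ij n k by auto
      then show "gc i j = xc 3 4 * g8_coeff \<alpha> i j"
        unfolding gc_xc[OF ij(3)] by (auto simp: g8_coeff_def low xc23 algebra_simps)
    qed
    then show ?thesis using n k by (auto simp: g8_bracket_def)
  next
    assume k: "k = 5" and c: "xc 3 4 \<noteq> 0"
    have le: "6 \<le> n + 1" "7 \<le> n + 1" "8 \<le> n + 1" "9 \<le> n + 1" "10 \<le> n + 1" using n k by simp_all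
    note low = x.low_weights(1)[OF le(1)] x.low_weights(2)[OF le(2)] x.low_weights(3,4)[OF le(3)]
      x.low_weights(5,6)[OF le(4)] x.low_weights(7-9)[OF le(5)]
    define \<alpha> where "\<alpha> = xc 2 3 / xc 3 4 - 2"
    have xc23: "xc 2 3 = xc 3 4 * (2 + \<alpha>)" using c by (simp add: \<alpha>_def field_simps)
    \<comment> \<open>The origin of the excluded parameter: the right side is nonzero, so
      \<open>2 * \<alpha> + 5\<close> is too, and \<open>xc 4 5\<close> is determined by
      \<alpha>.\<close>
    have "xc 3 4 * (xc 4 5 * (2 * \<alpha> + 5)) = xc 3 4 * (3 * xc 3 4)"
      using x.relation9[OF le(4)] unfolding xc23 by (simp add: power2_eq_square algebra_simps)
    then have rel: "xc 4 5 * (2 * \<alpha> + 5) = 3 * xc 3 4" using c by simp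
    then have \<alpha>: "2 * \<alpha> + 5 \<noteq> 0" using c by auto
    then have xc45: "xc 4 5 = xc 3 4 * (3 / (2 * \<alpha> + 5))" using rel by (simp add: field_simps)
    have "lie_isomorphic gr (graded_bracket n e (skew (g10_coeff \<alpha>)))"
    proof (rule isomorphic_scaled[OF c])
      show "g10_coeff \<alpha> 1 j = 1" for j by (simp add: g10_coeff_def g8_coeff_def)
      fix i j :: nat assume ij: "2 \<le> i" "i < j" "i + j \<le> n"
      have sum: "i + j \<le> 10" using ij n k by simp
      then have "i = 2 \<or> i = 3 \<or> i = 4" "j = 3 \<or> j = 4 \<or> j = 5 \<or> j = 6 \<or> j = 7 \<or> j = 8" using ij by auto
      then have "(i, j) \<in> {(2, 3), (2, 4), (2, 5), (2, 6), (3, 4), (3, 5), (2, 7), (3, 6), (4, 5), (2, 8), (3, 7), (4, 6)}"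
        using ij(2) sum by (elim disjE) simp_all
      then show "gc i j = xc 3 4 * g10_coeff \<alpha> i j"
        unfolding gc_xc[OF ij(3)] using \<alpha>
        by (auto simp: g10_coeff_def g8_coeff_def low xc23 xc45 field_simps power2_eq_square)
    qed
    moreover have "\<alpha> \<noteq> - 5 / 2" using \<alpha> by auto
    ultimately show ?thesis using n k by (auto simp: g10_bracket_def)
  qed
qed

end

end

theorem theorem7p2:
  fixes br :: "'a::real_vector \<Rightarrow> 'a \<Rightarrow> 'a" and k :: nat
  assumes "2 * k \<ge> 4"
    and "filiform (2 * k) br"
    and "symplectic br"
  shows "\<exists>e. adapted_basis (2 * k) br e \<and>
    nat_graded_filiform (2 * k) (assoc_graded (2 * k) br e) \<and>
    symplectic (assoc_graded (2 * k) br e) \<and>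
    (lie_isomorphic (assoc_graded (2 * k) br e) (m0_bracket (2 * k) e) \<or>
     (2 * k = 6 \<and> lie_isomorphic (assoc_graded (2 * k) br e) (V_bracket 6 e)) \<or>
     (k \<ge> 6 \<and> lie_isomorphic (assoc_graded (2 * k) br e) (V_bracket (2 * k) e)) \<or>
     (2 * k = 8 \<and> (\<exists>\<alpha>. symplectic (g8_bracket e \<alpha>) \<and>
        lie_isomorphic (assoc_graded (2 * k) br e) (g8_bracket e \<alpha>))) \<or>
     (2 * k = 10 \<and> (\<exists>\<alpha>. \<alpha> \<noteq> - 5 / 2 \<and> symplectic (g10_bracket e \<alpha>) \<and>
        lie_isomorphic (assoc_graded (2 * k) br e) (g10_bracket e \<alpha>)))) \<and>
    (\<forall>\<omega>. symplectic_form br \<omega> \<longrightarrow>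
      (\<exists>\<omega>\<^sub>0 \<gamma>. homogeneous_two_form (2 * k) e (2 * k + 1) \<omega>\<^sub>0 \<and>
         symplectic_form (assoc_graded (2 * k) br e) \<omega>\<^sub>0 \<and>
         (\<forall>x y. \<omega> x y = \<omega>\<^sub>0 x y +
            (\<Sum>(i, j) \<in> {(i, j). 1 \<le> i \<and> i < j \<and> j \<le> 2 * k \<and> i + j < 2 * k + 1}.
               \<gamma> i j * wedge (dual_basis (2 * k) e i) (dual_basis (2 * k) e j) x y))))"
proof -
  define n where "n = 2 * k"
  interpret filiform_algebra n br
    by unfold_locales (use assms in \<open>simp_all add: n_def\<close>)
  obtain e where frame: "filiform_frame n e br k" and e23: "br (e 2) (e 3) \<in> filtration n e 5"
    using exists_frame[OF n_def] by blast
  \<comment> \<open>One form is fixed in order to obtain the adapted basis and the classification;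
    the decomposition is then proved in that basis for every symplectic form.\<close>
  obtain \<omega> where \<omega>: "symplectic_form br \<omega>"
    using assms(3) by (auto simp: symplectic_def)
  interpret frame: filiform_frame n e br k by (rule frame)
  have "frame.d 2 3 = 0"
    using e23 n_ge by (simp add: frame.d_def frame.filtration_iff)
  then have adapted: "adapted_basis n br e"
    by (rule frame.adapted_basis[OF \<omega>])
  interpret adapted_frame n e br k
    by unfold_locales (rule adapted)
  have symplectic: "symplectic (assoc_graded n br e)"
    using symplectic_top_form[OF \<omega>] by (auto simp: symplectic_def)
  have classification: "lie_isomorphic (assoc_graded n br e) (m0_bracket n e) \<or>
     (n = 6 \<and> lie_isomorphic (assoc_graded n br e) (V_bracket 6 e)) \<or>
     (k \<ge> 6 \<and> lie_isomorphic (assoc_graded n br e) (V_bracket n e)) \<or>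
     (n = 8 \<and> (\<exists>\<alpha>. symplectic (g8_bracket e \<alpha>) \<and>
        lie_isomorphic (assoc_graded n br e) (g8_bracket e \<alpha>))) \<or>
     (n = 10 \<and> (\<exists>\<alpha>. \<alpha> \<noteq> - 5 / 2 \<and> symplectic (g10_bracket e \<alpha>) \<and>
        lie_isomorphic (assoc_graded n br e) (g10_bracket e \<alpha>)))"
    using gr_classification[OF \<omega>] symplectic_isomorphic[OF _ symplectic] by blast
  show ?thesis
    unfolding n_def[symmetric]
    by (intro exI[of _ e] conjI allI impI adapted nat_graded_gr symplectic classification)
      (rule form_decomposition)
qed

end
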